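(* Let $G$ be a strongly perfect graph with vertex set $\{x_1,\ldots,x_n\}$, let $\operatorname{cl}(G)$ be its clique clutter, let $R=K[x_1,\ldots,x_n]$ be a polynomial ring over a field $K$, and let $J=I(\operatorname{cl}(G)^\vee)\subset R$ be the ideal of covers of $\operatorname{cl}(G)$. Then (a) $\operatorname{depth}(R/J^{(k)})\geq\operatorname{depth}(R/J^{(k+1)})$ for all $k\geq 1$, and (b) $\operatorname{reg}(R/J^{(k)})\leq\operatorname{reg}(R/J^{(k+1)})$ for all $k\geq 1$.
   Context: A clique of a graph $G$ is a set of vertices inducing a complete subgraph. The clique clutter $\operatorname{cl}(G)$ is the clutter on $V(G)$ whose edges are the maximal cliques of $G$ (maximal with respect to inclusion). A graph $G$ is strongly perfect if every induced subgraph $H$ of $G$ has a maximal independent set of vertices $C$ such that $|C\cap e|=1$ for every maximal clique $e$ of $H$. For a clutter $\mathcal{C}$ (a family of subsets, called edges, of the vertex set, none included in another), $\mathcal{C}^\vee$ is the clutter of minimal vertex covers of $\mathcal{C}$ (inclusion-minimal vertex sets meeting every edge). The edge ideal $I(\mathcal{C})$ is generated by the monomials $\prod_{x_i\in e}x_i$, $e$ an edge. The ideal of covers of $\mathcal{C}$ is $I(\mathcal{C}^\vee)=\bigcap_{e}(e)$, where $e$ runs over the edges of $\mathcal{C}$ and $(e)$ is the ideal generated by the variables in $e$. For a squarefree monomial ideal $J$ with associated primes $\mathfrak{p}_1,\ldots,\mathfrak{p}_s$, the $k$-th symbolic power is $J^{(k)}=\mathfrak{p}_1^k\cap\cdots\cap\mathfrak{p}_s^k$.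 $\operatorname{reg}$ is Castelnuovo--Mumford regularity, and depth is with respect to the graded maximal ideal. *)

theory Defs
  imports
    "HOL-Library.Poly_Mapping"
    "HOL-Library.Extended_Nat"
    "HOL-Library.Extended_Real"
    "Jordan_Normal_Form.Matrix_Kernel"
begin

section \<open>Graphs and clutters\<close>

text \<open>
  A finite simple graph is a symmetric irreflexive relation \<open>E\<close> on a finite type \<open>'v\<close>, its vertex
  set being \<open>UNIV\<close>. The graph-theoretic notions below refer to the subgraph induced on \<open>W\<close>.
\<close>

definition clique :: "('v \<Rightarrow> 'v \<Rightarrow> bool) \<Rightarrow> 'v set \<Rightarrow> 'v set \<Rightarrow> bool" where
  "clique E W S \<longleftrightarrow> S \<subseteq> W \<and> (\<forall>x\<in>S. \<forall>y\<in>S. x \<noteq> y \<longrightarrow> E x y)"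

definition independent_set :: "('v \<Rightarrow> 'v \<Rightarrow> bool) \<Rightarrow> 'v set \<Rightarrow> 'v set \<Rightarrow> bool" where
  "independent_set E W S \<longleftrightarrow> S \<subseteq> W \<and> (\<forall>x\<in>S. \<forall>y\<in>S. \<not> E x y)"

definition maximal_clique :: "('v \<Rightarrow> 'v \<Rightarrow> bool) \<Rightarrow> 'v set \<Rightarrow> 'v set \<Rightarrow> bool" where
  "maximal_clique E W S \<longleftrightarrow> clique E W S \<and> (\<forall>T. clique E W T \<and> S \<subseteq> T \<longrightarrow> T = S)"

definition maximal_independent_set :: "('v \<Rightarrow> 'v \<Rightarrow> bool) \<Rightarrow> 'v set \<Rightarrow> 'v set \<Rightarrow> bool" where
  "maximal_independent_set E W S \<longleftrightarrow>
     independent_set E W S \<and> (\<forall>T. independent_set E W T \<and> S \<subseteq> T \<longrightarrow> T = S)"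

text \<open>
  Induced subgraphs have at least one vertex: in the graph without vertices the only
  maximal clique would be empty, and no set meets it in exactly one vertex.
\<close>

definition strongly_perfect :: "('v \<Rightarrow> 'v \<Rightarrow> bool) \<Rightarrow> bool" where
  "strongly_perfect E \<longleftrightarrow>
     (\<forall>W. W \<noteq> {} \<longrightarrow>
       (\<exists>C. maximal_independent_set E W C \<and> (\<forall>e. maximal_clique E W e \<longrightarrow> card (C \<inter> e) = 1)))"

definition clique_clutter :: "('v \<Rightarrow> 'v \<Rightarrow> bool) \<Rightarrow> 'v set set" where
  "clique_clutter E = {e. maximal_clique E UNIV e}"

definition vertex_cover :: "'v set set \<Rightarrow> 'v set \<Rightarrow> bool" where
  "vertex_cover H C \<longleftrightarrow> (\<forall>e\<in>H. C \<inter> e \<noteq> {})"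

definition blocker :: "'v set set \<Rightarrow> 'v set set" where
  "blocker H = {C. vertex_cover H C \<and> (\<forall>D. vertex_cover H D \<and> D \<subseteq> C \<longrightarrow> D = C)}"


section \<open>Ideals of a polynomial ring\<close>

text \<open>\<open>('v, 'k) mpoly\<close> is the polynomial ring over \<open>'k\<close> with one variable for each element of \<open>'v\<close>.\<close>

type_synonym ('v, 'k) mpoly = "('v \<Rightarrow>\<^sub>0 nat) \<Rightarrow>\<^sub>0 'k"

definition indet :: "'v \<Rightarrow> ('v, 'k::comm_ring_1) mpoly" where
  "indet x = Poly_Mapping.single (Poly_Mapping.single x 1) 1"

definition mdeg :: "('v \<Rightarrow>\<^sub>0 nat) \<Rightarrow> nat" where
  "mdeg m = (\<Sum>x\<in>Poly_Mapping.keys m. Poly_Mapping.lookup m x)"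

text \<open>Ideals are the submodules of the ring regarded as a module over itself.\<close>

abbreviation ring_ideal :: "'a::comm_ring_1 set \<Rightarrow> bool" where
  "ring_ideal \<equiv> Modules.module.subspace (*)"

abbreviation ideal_gen :: "'a::comm_ring_1 set \<Rightarrow> 'a set" where
  "ideal_gen \<equiv> Modules.module.span (*)"

primrec ideal_power :: "'a::comm_ring_1 set \<Rightarrow> nat \<Rightarrow> 'a set" where
  "ideal_power I 0 = UNIV"
| "ideal_power I (Suc k) = ideal_gen {a * b | a b. a \<in> I \<and> b \<in> ideal_power I k}"

definition prime_ideal :: "'a::comm_ring_1 set \<Rightarrow> bool" where
  "prime_ideal P \<longleftrightarrow>
     ring_ideal P \<and> P \<noteq> UNIV \<and> (\<forall>a b. a * b \<in> P \<longrightarrow> a \<in> P \<or> b \<in> P)"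

definition associated_primes :: "'a::comm_ring_1 set \<Rightarrow> 'a set set" where
  "associated_primes I = {P. prime_ideal P \<and> (\<exists>f. P = {g. g * f \<in> I})}"

text \<open>
  This is the symbolic power of an ideal that, like a squarefree monomial ideal, is the
  intersection of its associated primes; it is not meant for other ideals.
\<close>

definition symbolic_power :: "'a::comm_ring_1 set \<Rightarrow> nat \<Rightarrow> 'a set" where
  "symbolic_power I k = (\<Inter>P\<in>associated_primes I. ideal_power P k)"

definition edge_ideal :: "'v set set \<Rightarrow> ('v, 'k::comm_ring_1) mpoly set" where
  "edge_ideal H = ideal_gen ((\<lambda>e. \<Prod>x\<in>e. indet x) ` H)"

definition graded_maximal_ideal :: "('v, 'k::comm_ring_1) mpoly set" where
  "graded_maximal_ideal = ideal_gen (range indet)"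


section \<open>Depth\<close>

text \<open>
  The sequence \<open>fs\<close> is regular on \<open>R/I\<close>; being a nonzerodivisor on
  \<open>R/(I + (f\<^sub>0, \<dots>, f\<^sub>i\<^sub>-\<^sub>1))\<close> is expressed by membership in \<open>I + (f\<^sub>0, \<dots>, f\<^sub>i\<^sub>-\<^sub>1)\<close>.
\<close>

definition regular_sequence_quot :: "'a::comm_ring_1 set \<Rightarrow> 'a list \<Rightarrow> bool" where
  "regular_sequence_quot I fs \<longleftrightarrow>
     ideal_gen (I \<union> set fs) \<noteq> UNIV \<and>
     (\<forall>i<length fs. \<forall>g. fs ! i * g \<in> ideal_gen (I \<union> set (take i fs)) \<longrightarrow>
        g \<in> ideal_gen (I \<union> set (take i fs)))"

text \<open>\<open>depth_quot I\<close> is the depth of \<open>R/I\<close> with respect to the graded maximal ideal.\<close>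

definition depth_quot :: "('v, 'k::comm_ring_1) mpoly set \<Rightarrow> enat" where
  "depth_quot I =
     (SUP fs\<in>{fs. set fs \<subseteq> graded_maximal_ideal \<and> regular_sequence_quot I fs}. enat (length fs))"


section \<open>Castelnuovo-Mumford regularity\<close>

definition mat_image :: "'a::comm_ring_1 mat \<Rightarrow> 'a vec set" where
  "mat_image A = (\<lambda>w. A *\<^sub>v w) ` carrier_vec (dim_col A)"

text \<open>
  A graded free resolution \<open>\<dots> \<rightarrow> F\<^sub>2 \<rightarrow> F\<^sub>1 \<rightarrow> F\<^sub>0 = R \<rightarrow> R/I \<rightarrow> 0\<close> of \<open>R/I\<close>, given by shifts
  and matrices: \<open>F\<^sub>i\<close> is the direct sum of the \<open>R(-j)\<close> for \<open>j\<close> in the list \<open>d i\<close>, and the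
  matrix \<open>\<phi> i\<close> describes \<open>F\<^sub>i\<^sub>+\<^sub>1 \<rightarrow> F\<^sub>i\<close>. This map has degree 0 iff each entry \<open>(p, q)\<close> is
  homogeneous of degree \<open>d (i + 1) ! q - d i ! p\<close> (zero if this number is negative).
\<close>

definition graded_free_resolution ::
    "('v, 'k::comm_ring_1) mpoly set \<Rightarrow> (nat \<Rightarrow> int list) \<Rightarrow> (nat \<Rightarrow> ('v, 'k) mpoly mat) \<Rightarrow> bool" where
  "graded_free_resolution I d \<phi> \<longleftrightarrow>
     d 0 = [0] \<and>
     (\<forall>i. \<phi> i \<in> carrier_mat (length (d i)) (length (d (Suc i)))) \<and>
     (\<forall>i. \<forall>p<length (d i). \<forall>q<length (d (Suc i)). \<forall>m\<in>Poly_Mapping.keys (\<phi> i $$ (p, q)).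
        int (mdeg m) = d (Suc i) ! q - d i ! p) \<and>
     mat_image (\<phi> 0) = {v \<in> carrier_vec 1. v $ 0 \<in> I} \<and>
     (\<forall>i. mat_kernel (\<phi> i) = mat_image (\<phi> (Suc i)))"

definition minimal_graded_free_resolution ::
    "('v, 'k::comm_ring_1) mpoly set \<Rightarrow> (nat \<Rightarrow> int list) \<Rightarrow> (nat \<Rightarrow> ('v, 'k) mpoly mat) \<Rightarrow> bool" where
  "minimal_graded_free_resolution I d \<phi> \<longleftrightarrow>
     graded_free_resolution I d \<phi> \<and> (\<forall>i. elements_mat (\<phi> i) \<subseteq> graded_maximal_ideal)"

text \<open>
  For a proper homogeneous ideal \<open>I\<close> in finitely many variables over a field a minimal graded
  free resolution of \<open>R/I\<close> exists and is unique up to isomorphism, so that the graded Betti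
  numbers of \<open>R/I\<close> do not depend on the resolution chosen here.
\<close>

definition minimal_shifts :: "('v, 'k::comm_ring_1) mpoly set \<Rightarrow> nat \<Rightarrow> int list" where
  "minimal_shifts I = (SOME d. \<exists>\<phi>. minimal_graded_free_resolution I d \<phi>)"

definition graded_betti :: "('v, 'k::comm_ring_1) mpoly set \<Rightarrow> nat \<Rightarrow> int \<Rightarrow> nat" where
  "graded_betti I i j = count_list (minimal_shifts I i) j"

text \<open>
  \<open>reg_quot I\<close> is the regularity of \<open>R/I\<close>. Only finitely many Betti numbers are nonzero, so the
  supremum is a maximum; taking it in \<open>ereal\<close> makes it meaningful before this is known.
\<close>

definition reg_quot :: "('v, 'k::comm_ring_1) mpoly set \<Rightarrow> ereal" where
  "reg_quot I = (SUP (i, j)\<in>{(i, j). graded_betti I i j \<noteq> 0}. ereal (real_of_int (j - int i)))"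

end

theory Submission
  imports Defs
begin

text \<open>
  Let \<open>C\<close> be a set of vertices that meets every maximal clique of \<open>G\<close> in exactly one vertex; strong
  perfection, applied to \<open>G\<close> itself, provides it. The associated primes of \<open>J\<close> are the ideals \<open>(e)\<close> of
  the maximal cliques \<open>e\<close>, so that a monomial \<open>x\<^sup>a\<close> lies in \<open>J\<^bsup>(k)\<^esup>\<close> iff its degree in the variables of
  each \<open>e\<close> is at least \<open>k\<close> (\<open>symbolic_power_cover_ideal\<close>). Multiplication by \<open>x\<^sup>C\<close>, the product of the
  variables in \<open>C\<close>, raises all these degrees by one, whence \<open>J\<^bsup>(k)\<^esup> = (J\<^bsup>(k+1)\<^esup> : x\<^sup>C)\<close>
  (\<open>cover_upset_eq_colon\<close>). The theorem follows from a general fact: when a monomial ideal \<open>I\<close> is replaced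
  by \<open>(I : x\<^sup>c)\<close> for a monomial \<open>x\<^sup>c\<close> outside \<open>I\<close>, the depth of the quotient does not decrease and its
  regularity does not increase.

  Regularity (\<open>reg_quot_colon\<close>). The minimal free resolution of \<open>R/I\<close> can be chosen graded by
  monomials. Keep only the parts of degree at least \<open>c\<close> and shift them by \<open>c\<close>. This is exact, turns
  \<open>R/I\<close> into \<open>R/(I : x\<^sup>c)\<close>, and turns \<open>R(-g)\<close> into the free module generated in degree \<open>max (g - c) 0\<close>.
  The result is a graded free resolution of \<open>R/(I : x\<^sup>c)\<close>, in general not minimal, none of whose
  shifts has grown. It bounds the regularity, because the shifts of a minimal graded resolution occur in every
  graded resolution (\<open>minimal_resolution_shifts_subset\<close>).

  Depth (\<open>depth_quot_colon\<close>). Let \<open>N\<close> exceed all exponents of the minimal generators of \<open>I\<close>. Over the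
  subring \<open>A\<close> of the polynomials in the \<open>N\<close>-th powers of the variables, \<open>R/I\<close> is the direct sum of the
  pieces spanned by the monomials of a given residue vector modulo \<open>N\<close>, and each piece of \<open>R/(I : x\<^sup>c)\<close> is
  isomorphic to one of \<open>R/I\<close>. Therefore a sequence in \<open>A\<close> that is regular on \<open>R/I\<close> is regular on
  \<open>R/(I : x\<^sup>c)\<close>. It remains to replace a regular sequence in the graded maximal ideal \<open>\<mm>\<close> by an equally
  long one in \<open>A \<inter> \<mm>\<close>. This is possible because a prime ideal that contains \<open>A \<inter> \<mm>\<close> contains \<open>\<mm>\<close>, by
  prime avoidance in the Noetherian ring \<open>R\<close> (\<open>regular_sequence_quot_exchange\<close>).
\<close>

section \<open>Zero divisors modulo an ideal of a Noetherian ring\<close>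

interpretation ideal: Modules.module "(*) :: 'a::comm_ring_1 \<Rightarrow> 'a \<Rightarrow> 'a"
  by unfold_locales (auto simp: algebra_simps)

(* As a rewrite rule it reassociates products, against mult.assoc. *)
declare ideal.scale_scale [simp del]

definition noetherian_ring_type :: "'a::comm_ring_1 itself \<Rightarrow> bool" where
  "noetherian_ring_type _ \<longleftrightarrow> wf {(J, I :: 'a set). ring_ideal I \<and> ring_ideal J \<and> I \<subset> J}"

lemma ideal_mult_right: "ring_ideal I \<Longrightarrow> a \<in> I \<Longrightarrow> a * r \<in> I"
  by (metis ideal.subspace_scale mult.commute)

lemma ideal_gen_ideal: "ring_ideal I \<Longrightarrow> ideal_gen I = I"
  by simp

lemma ideal_one_iff: "ring_ideal (I :: 'a::comm_ring_1 set) \<Longrightarrow> 1 \<in> I \<longleftrightarrow> I = UNIV"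
  using ideal_mult_right[of I 1] by auto

lemma in_ideal_gen_insert_iff:
  assumes "ring_ideal I"
  shows "x \<in> ideal_gen (insert f I) \<longleftrightarrow> (\<exists>r. x - r * f \<in> I)"
  using assms by (subst ideal.span_insert) (simp add: ideal.span_eq_iff[THEN iffD2])

lemma ideal_gen_idem_Un: "ideal_gen (ideal_gen A \<union> B) = ideal_gen (A \<union> (B :: 'a::comm_ring_1 set))"
  by (simp add: ideal.span_Un ideal.span_span)

lemma ring_ideal_colon:
  assumes "ring_ideal I"
  shows "ring_ideal {h. h * g \<in> I}"
proof (rule ideal.subspaceI)
  show "x + y \<in> {h. h * g \<in> I}" if "x \<in> {h. h * g \<in> I}" "y \<in> {h. h * g \<in> I}" for x y
    using that assms by (auto simp: distrib_right intro: ideal.subspace_add)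
  show "c * x \<in> {h. h * g \<in> I}" if "x \<in> {h. h * g \<in> I}" for c x
    using that ideal.subspace_scale[OF assms, of "x * g" c] by (simp add: mult.assoc)
qed (use assms in \<open>simp add: ideal.subspace_0\<close>)

text \<open>
  A colon ideal \<open>(I : g)\<close> that is maximal among the proper ones is prime: if \<open>a \<notin> (I : g)\<close>,
  then \<open>(I : a g)\<close> is proper and contains \<open>(I : g)\<close>, so that the two agree.
\<close>

lemma zero_divisor_in_associated_prime:
  fixes I :: "'a::comm_ring_1 set"
  assumes noeth: "noetherian_ring_type TYPE('a)" and I: "ring_ideal I"
    and cg: "c * g \<in> I" and g: "g \<notin> I"
  shows "\<exists>P\<in>associated_primes I. c \<in> P"
proof -
  let ?R = "{(J, I :: 'a set). ring_ideal I \<and> ring_ideal J \<and> I \<subset> J}"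
  let ?S = "{{h. h * f \<in> I} | f. f \<notin> I \<and> c * f \<in> I}"
  have "wf ?R" using noeth by (simp add: noetherian_ring_type_def)
  moreover have "{h. h * g \<in> I} \<in> ?S" using cg g by auto
  ultimately obtain P where P: "P \<in> ?S" and max: "\<And>J. (J, P) \<in> ?R \<Longrightarrow> J \<notin> ?S"
    by (rule wfE_min) blast
  obtain f where f: "f \<notin> I" "c * f \<in> I" and Pf: "P = {h. h * f \<in> I}"
    using P by auto
  have "prime_ideal P"
    unfolding prime_ideal_def
  proof (intro conjI allI impI)
    show "ring_ideal P" unfolding Pf by (rule ring_ideal_colon[OF I])
    show "P \<noteq> UNIV"
    proof
      assume "P = UNIV"
      then have "1 \<in> P" by simp
      then show False using f by (simp add: Pf)
    qed
    show "a \<in> P \<or> b \<in> P" if ab: "a * b \<in> P" for a b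
    proof (rule disjCI)
      assume b: "b \<notin> P"
      let ?J = "{h. h * (b * f) \<in> I}"
      have sub: "P \<subseteq> ?J"
      proof
        fix h assume "h \<in> P"
        then have "b * (h * f) \<in> I" using ideal.subspace_scale[OF I] by (auto simp: Pf)
        then show "h \<in> ?J" by (simp add: mult.left_commute)
      qed
      have "c * (b * f) \<in> I"
        using ideal.subspace_scale[OF I f(2), of b] by (simp add: mult.left_commute)
      then have "?J \<in> ?S" using b by (auto simp: Pf)
      with max[of ?J] sub ring_ideal_colon[OF I] have "?J = P"
        unfolding Pf by blast
      then show "a \<in> P" using ab by (auto simp: Pf mult.assoc)
    qed
  qed
  then have "P \<in> associated_primes I" using Pf by (auto simp: associated_primes_def)
  moreover have "c \<in> P" using f by (simp add: Pf)
  ultimately show ?thesis by blast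
qed

text \<open>
  If \<open>P = (I : g)\<close> is prime, then \<open>R/P\<close> embeds into \<open>R/I\<close> with cokernel \<open>R/(I + (g))\<close>, so that
  \<open>P\<close> is the only associated prime of \<open>I\<close> that can fail to be one of \<open>I + (g)\<close>.
\<close>

lemma associated_primes_step:
  fixes I :: "'a::comm_ring_1 set"
  assumes I: "ring_ideal I" and P: "prime_ideal P" and Pg: "P = {h. h * g \<in> I}"
  shows "associated_primes I \<subseteq> insert P (associated_primes (ideal_gen (insert g I)))"
proof
  fix Q assume "Q \<in> associated_primes I"
  then obtain f where Q: "prime_ideal Q" and Qf: "Q = {h. h * f \<in> I}"
    by (auto simp: associated_primes_def)
  show "Q \<in> insert P (associated_primes (ideal_gen (insert g I)))"
  proof (cases "\<exists>r. r * f \<in> ideal_gen (insert g I) \<and> r * f \<notin> I")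
    case True
    then obtain r s where rs: "r * f - s * g \<in> I" and r: "r * f \<notin> I"
      by (auto simp: in_ideal_gen_insert_iff[OF I])
    have eq: "h * (r * f) \<in> I \<longleftrightarrow> h * (s * g) \<in> I" for h
    proof -
      have "h * (r * f) - h * (s * g) \<in> I"
        using ideal.subspace_scale[OF I rs, of h] by (simp add: algebra_simps)
      then show ?thesis
        using ideal.subspace_diff[OF I, of "h * (r * f)" "h * (r * f) - h * (s * g)"]
          ideal.subspace_add[OF I, of "h * (s * g)" "h * (r * f) - h * (s * g)"] by auto
    qed
    have s: "s \<notin> P" using eq[of 1] r by (simp add: Pg)
    have "h \<in> Q \<longleftrightarrow> h \<in> P" for h
    proof -
      have "h \<in> Q \<longleftrightarrow> h * r \<in> Q"
        using Q r ideal_mult_right[of Q h r] unfolding prime_ideal_def by (auto simp: Qf)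
      also have "\<dots> \<longleftrightarrow> h * s \<in> P"
        using eq[of h] by (simp add: Qf Pg mult.assoc)
      also have "\<dots> \<longleftrightarrow> h \<in> P"
        using P s ideal_mult_right[of P h s] unfolding prime_ideal_def by auto
      finally show ?thesis .
    qed
    then show ?thesis by auto
  next
    case False
    have "Q = {h. h * f \<in> ideal_gen (insert g I)}"
      using False ideal.span_superset[of "insert g I"] by (auto simp: Qf)
    then show ?thesis using Q by (auto simp: associated_primes_def)
  qed
qed

lemma finite_associated_primes:
  fixes I :: "'a::comm_ring_1 set"
  assumes noeth: "noetherian_ring_type TYPE('a)" and "ring_ideal I"
  shows "finite (associated_primes I)"
proof -
  let ?R = "{(J, I :: 'a set). ring_ideal I \<and> ring_ideal J \<and> I \<subset> J}"
  have "wf ?R" using noeth by (simp add: noetherian_ring_type_def)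
  then have "ring_ideal I \<longrightarrow> finite (associated_primes I)"
  proof (induction I)
    case (less I)
    show ?case
    proof
      assume I: "ring_ideal I"
      show "finite (associated_primes I)"
      proof (cases "associated_primes I = {}")
        case False
        then obtain P g where P: "prime_ideal P" and Pg: "P = {h. h * g \<in> I}"
          by (auto simp: associated_primes_def)
        have "g \<notin> I"
        proof
          assume "g \<in> I"
          then have "P = UNIV" using ideal.subspace_scale[OF I] by (auto simp: Pg)
          then show False using P by (simp add: prime_ideal_def)
        qed
        then have "I \<subset> ideal_gen (insert g I)"
          using ideal.span_superset[of "insert g I"] by auto
        then have "finite (associated_primes (ideal_gen (insert g I)))"
          using less I by auto
        then show ?thesis
          by (rule finite_subset[OF associated_primes_step[OF I P Pg], OF finite.insertI])
      qed simp
    qed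
  qed
  then show ?thesis using assms by simp
qed

text \<open>
  Prime avoidance for a set that is merely closed under addition and multiplication. In a
  minimal cover by primes choose for each prime an element that lies in no other one; adding one
  of these elements to the product of the others gives an element that lies in no prime.
\<close>

lemma prime_avoidance:
  fixes S :: "'a::comm_ring_1 set"
  assumes add: "\<And>x y. x \<in> S \<Longrightarrow> y \<in> S \<Longrightarrow> x + y \<in> S"
    and mult: "\<And>x y. x \<in> S \<Longrightarrow> y \<in> S \<Longrightarrow> x * y \<in> S"
    and "S \<noteq> {}" and "finite Ps" and "\<And>P. P \<in> Ps \<Longrightarrow> prime_ideal P"
    and "S \<subseteq> \<Union>Ps"
  shows "\<exists>P\<in>Ps. S \<subseteq> P"
  using assms(4-)
proof (induction "card Ps" arbitrary: Ps rule: less_induct)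
  case less
  show ?case
  proof (cases "\<exists>P\<in>Ps. S \<subseteq> \<Union>(Ps - {P})")
    case True
    then obtain P where P: "P \<in> Ps" "S \<subseteq> \<Union>(Ps - {P})" by blast
    have "card (Ps - {P}) < card Ps"
      using less.prems(1) P(1) by (rule card_Diff1_less)
    from less.hyps[OF this] less.prems P(2) show ?thesis by auto
  next
    case False
    then have "\<forall>P\<in>Ps. \<exists>s\<in>S. s \<notin> \<Union>(Ps - {P})" by blast
    then obtain s where s: "\<And>P. P \<in> Ps \<Longrightarrow> s P \<in> S"
      and s': "\<And>P Q. P \<in> Ps \<Longrightarrow> Q \<in> Ps \<Longrightarrow> Q \<noteq> P \<Longrightarrow> s P \<notin> Q"
      by (metis (no_types, lifting) DiffI UnionI singletonD)
    have ss: "s P \<in> P" if "P \<in> Ps" for P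
      using s[OF that] s'[OF that] less.prems(3) by blast
    obtain P where P: "P \<in> Ps" using \<open>S \<noteq> {}\<close> less.prems(3) by blast
    show ?thesis
    proof (cases "Ps = {P}")
      case True
      then show ?thesis using less.prems(3) by auto
    next
      case False
      have prod_in: "prod s F \<in> S" if "finite F" "F \<noteq> {}" "F \<subseteq> Ps" for F
        using that by (induction F rule: finite_ne_induct) (auto intro: mult s)
      have prod_notin: "prod s F \<notin> P" if "finite F" "F \<subseteq> Ps - {P}" for F
        using that
      proof (induction F rule: finite_induct)
        case empty
        then show ?case using less.prems(2)[OF P] by (auto simp: prime_ideal_def ideal_one_iff)
      next
        case (insert Q F)
        then show ?case using less.prems(2)[OF P] s'[of Q P] P by (auto simp: prime_ideal_def)
      qed
      define y where "y = prod s (Ps - {P})"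
      have fin: "finite (Ps - {P})" using less.prems(1) by simp
      have ne: "Ps - {P} \<noteq> {}" using False P by auto
      have yS: "y \<in> S" unfolding y_def by (rule prod_in[OF fin ne]) auto
      have yP: "y \<notin> P" unfolding y_def by (rule prod_notin[OF fin]) auto
      have yQ: "y \<in> Q" if "Q \<in> Ps" "Q \<noteq> P" for Q
      proof -
        have "y = s Q * prod s (Ps - {P} - {Q})"
          unfolding y_def by (rule prod.remove[OF fin]) (use that in auto)
        then show ?thesis
          using ideal_mult_right ss[OF that(1)] less.prems(2)[OF that(1)]
          by (auto simp: prime_ideal_def)
      qed
      have "s P + y \<in> S" using s[OF P] yS add by blast
      then obtain Q where Q: "Q \<in> Ps" "s P + y \<in> Q" using less.prems(3) by blast
      have idQ: "ring_ideal Q" using less.prems(2)[OF Q(1)] by (simp add: prime_ideal_def)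
      show ?thesis
      proof (cases "Q = P")
        case True
        then have "s P + y - s P \<in> P" using Q ideal.subspace_diff[OF idQ] ss[OF P] by blast
        then show ?thesis using yP by simp
      next
        case False
        then have "s P + y - y \<in> Q" using Q ideal.subspace_diff[OF idQ] yQ by blast
        then show ?thesis using s'[OF P Q(1)] False by simp
      qed
    qed
  qed
qed


section \<open>Exchanging regular sequences\<close>

lemma regular_sequence_quot_Cons:
  assumes "ring_ideal I"
  shows "regular_sequence_quot I (f # fs) \<longleftrightarrow>
    (\<forall>g. f * g \<in> I \<longrightarrow> g \<in> I) \<and> regular_sequence_quot (ideal_gen (insert f I)) fs"
proof -
  have I: "ideal_gen I = I" using assms by simp
  have gen: "ideal_gen (ideal_gen (insert f I) \<union> B) = ideal_gen (insert f (I \<union> B))" for B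
    by (simp add: ideal_gen_idem_Un)
  show ?thesis
    by (simp add: regular_sequence_quot_def All_less_Suc2 gen I)
      blast
qed

lemma regular_sequence_quot_append_left:
  assumes "regular_sequence_quot I (fs @ gs)"
  shows "regular_sequence_quot I fs"
proof -
  have "ideal_gen (I \<union> set fs) \<noteq> UNIV"
    using assms ideal.span_mono[of "I \<union> set fs" "I \<union> set (fs @ gs)"]
    by (auto simp: regular_sequence_quot_def)
  moreover have "g \<in> ideal_gen (I \<union> set (take i fs))"
    if "i < length fs" "fs ! i * g \<in> ideal_gen (I \<union> set (take i fs))" for i g
    using assms that unfolding regular_sequence_quot_def
    by (auto simp: nth_append dest!: spec[of _ i])
  ultimately show ?thesis by (auto simp: regular_sequence_quot_def)
qed

text \<open>
  An element \<open>c\<close> that is a nonzerodivisor at every stage of a regular sequence may be moved to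
  its front. The step: if \<open>f g \<equiv> c s\<close> modulo \<open>I\<close>, then \<open>s \<equiv> f u\<close> modulo \<open>I\<close> because \<open>c\<close> is regular
  modulo \<open>I + (f)\<close>, and cancelling \<open>f\<close> gives \<open>g \<equiv> c u\<close>.
\<close>

lemma regular_sequence_quot_move_to_front:
  assumes "ring_ideal I" and "regular_sequence_quot I fs"
    and "\<And>i g. i \<le> length fs \<Longrightarrow> c * g \<in> ideal_gen (I \<union> set (take i fs)) \<Longrightarrow>
           g \<in> ideal_gen (I \<union> set (take i fs))"
    and "ideal_gen (insert c I \<union> set fs) \<noteq> UNIV"
  shows "regular_sequence_quot I (c # fs)"
proof -
  have "regular_sequence_quot (ideal_gen (insert c I)) fs"
    using assms
  proof (induction fs arbitrary: I)
    case Nil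
    then show ?case by (simp add: regular_sequence_quot_def ideal.span_span)
  next
    case (Cons f fs)
    have I: "ring_ideal I" by fact
    have f: "g \<in> I" if "f * g \<in> I" for g
      using Cons.prems(2) that by (simp add: regular_sequence_quot_Cons[OF I])
    have cI: "g \<in> I" if "c * g \<in> I" for g
      using Cons.prems(3)[of 0 g] that by (simp add: ideal_gen_ideal[OF I])
    have cf: "g \<in> ideal_gen (insert f I)" if "c * g \<in> ideal_gen (insert f I)" for g
      using Cons.prems(3)[of 1 g] that by simp
    have gen: "ideal_gen (insert c (ideal_gen (insert f I))) = ideal_gen (insert f (insert c I))"
      "ideal_gen (insert f (ideal_gen (insert c I))) = ideal_gen (insert f (insert c I))"
      using ideal_gen_idem_Un[of "insert f I" "{c}"] ideal_gen_idem_Un[of "insert c I" "{f}"]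
      by (simp_all add: insert_commute)
    have gen': "ideal_gen (ideal_gen (insert f I) \<union> B) = ideal_gen (insert f (I \<union> B))" for B
      by (simp add: ideal_gen_idem_Un)
    have gen'': "ideal_gen (insert c (ideal_gen (insert f I) \<union> B))
        = ideal_gen (insert c (insert f (I \<union> B)))" for B
      using ideal_gen_idem_Un[of "insert f I" "insert c B"] by (simp add: insert_commute)
    have tail: "regular_sequence_quot (ideal_gen (insert c (ideal_gen (insert f I)))) fs"
    proof (rule Cons.IH)
      show "regular_sequence_quot (ideal_gen (insert f I)) fs"
        using Cons.prems(2) by (simp add: regular_sequence_quot_Cons[OF I])
      show "g \<in> ideal_gen (ideal_gen (insert f I) \<union> set (take i fs))"
        if "i \<le> length fs" "c * g \<in> ideal_gen (ideal_gen (insert f I) \<union> set (take i fs))" for i g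
        using Cons.prems(3)[of "Suc i" g] that by (simp add: gen')
      show "ideal_gen (insert c (ideal_gen (insert f I)) \<union> set fs) \<noteq> UNIV"
        using Cons.prems(4) by (simp add: gen'' insert_commute)
    qed simp
    have "g \<in> ideal_gen (insert c I)" if fg: "f * g \<in> ideal_gen (insert c I)" for g
    proof -
      obtain s where s: "f * g - s * c \<in> I"
        using fg by (auto simp: in_ideal_gen_insert_iff[OF I])
      then have "c * s - g * f \<in> I"
        using ideal.subspace_neg[OF I s] by (simp add: algebra_simps)
      then have "c * s \<in> ideal_gen (insert f I)" by (auto simp: in_ideal_gen_insert_iff[OF I])
      then have "s \<in> ideal_gen (insert f I)" by (rule cf)
      then obtain u where u: "s - u * f \<in> I" by (auto simp: in_ideal_gen_insert_iff[OF I])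
      have "f * (g - u * c) \<in> I"
        using ideal.subspace_add[OF I s ideal_mult_right[OF I u, of c]] by (simp add: algebra_simps)
      then show ?thesis using f by (auto simp: in_ideal_gen_insert_iff[OF I])
    qed
    then show ?case
      using tail by (simp add: regular_sequence_quot_Cons gen)
  qed
  moreover have "g \<in> I" if "c * g \<in> I" for g
    using assms(3)[of 0 g] that by (simp add: ideal_gen_ideal[OF assms(1)])
  ultimately show ?thesis using assms(1) by (simp add: regular_sequence_quot_Cons)
qed

text \<open>
  Regular sequences in \<open>\<mm>\<close> can be replaced by equally long ones in \<open>S\<close> as soon as no prime other
  than those containing \<open>\<mm>\<close> contains \<open>S\<close>. Since the associated primes of
  \<open>I + (f\<^sub>0, \<dots>, f\<^sub>i\<^sub>-\<^sub>1)\<close> do not contain \<open>f\<^sub>i\<close>, prime avoidance gives a \<open>c \<in> S\<close> that is regular at every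
  stage; it is moved to the front at the cost of the last entry, and the remaining entries are
  replaced modulo \<open>I + (c)\<close>.
\<close>

lemma regular_sequence_quot_exchange:
  fixes I :: "'a::comm_ring_1 set"
  assumes noeth: "noetherian_ring_type TYPE('a)"
    and M: "ring_ideal M" "M \<noteq> UNIV"
    and S: "S \<subseteq> M" "S \<noteq> {}"
    and add: "\<And>x y. x \<in> S \<Longrightarrow> y \<in> S \<Longrightarrow> x + y \<in> S"
    and mult: "\<And>x y. x \<in> S \<Longrightarrow> y \<in> S \<Longrightarrow> x * y \<in> S"
    and prime: "\<And>P. prime_ideal P \<Longrightarrow> S \<subseteq> P \<Longrightarrow> M \<subseteq> P"
    and "ring_ideal I" "I \<subseteq> M" "regular_sequence_quot I fs" "set fs \<subseteq> M"
  shows "\<exists>gs. set gs \<subseteq> S \<and> length gs = length fs \<and> regular_sequence_quot I gs"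
  using assms(9-)
proof (induction "length fs" arbitrary: I fs)
  case 0
  then show ?case by auto
next
  case (Suc n)
  have I: "ring_ideal I" by fact
  let ?K = "\<lambda>i. ideal_gen (I \<union> set (take i fs))"
  have proper: "ideal_gen A \<noteq> UNIV" if "A \<subseteq> M" for A
    using ideal.span_minimal[OF that M(1)] M(2) by auto
  let ?Ps = "\<Union>i<length fs. associated_primes (?K i)"
  have "finite ?Ps" using finite_associated_primes[OF noeth] by simp
  have notin: "\<not> S \<subseteq> P" if "P \<in> ?Ps" for P
  proof
    assume SP: "S \<subseteq> P"
    obtain i g where i: "i < length fs" and P: "prime_ideal P" and Pg: "P = {h. h * g \<in> ?K i}"
      using \<open>P \<in> ?Ps\<close> by (auto simp: associated_primes_def)
    have "fs ! i \<in> P" using prime[OF P SP] Suc.prems(4) i by (meson nth_mem subsetD)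
    then have "g \<in> ?K i"
      using Suc.prems(3) i by (auto simp: regular_sequence_quot_def Pg)
    then have "P = UNIV" by (auto simp: Pg intro: ideal.span_scale)
    then show False using P by (simp add: prime_ideal_def)
  qed
  have "\<not> S \<subseteq> \<Union>?Ps"
  proof
    assume "S \<subseteq> \<Union>?Ps"
    then have "\<exists>P\<in>?Ps. S \<subseteq> P"
      by (intro prime_avoidance add mult S(2) \<open>finite ?Ps\<close>) (auto simp: associated_primes_def)
    then show False using notin by blast
  qed
  then obtain c where c: "c \<in> S" "c \<notin> \<Union>?Ps" by blast
  have creg: "g \<in> ?K i" if "i < length fs" "c * g \<in> ?K i" for i g
    using zero_divisor_in_associated_prime[OF noeth _ that(2)] c(2) that(1) by auto
  obtain fs' f where fs: "fs = fs' @ [f]"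
    using Suc.hyps(2) by (metis length_0_conv nat.distinct(1) rev_exhaust)
  have cfs: "regular_sequence_quot I (c # fs')"
  proof (rule regular_sequence_quot_move_to_front[OF I])
    show "regular_sequence_quot I fs'"
      using Suc.prems(3) unfolding fs by (rule regular_sequence_quot_append_left)
    show "g \<in> ideal_gen (I \<union> set (take i fs'))"
      if "i \<le> length fs'" "c * g \<in> ideal_gen (I \<union> set (take i fs'))" for i g
      using creg[of i g] that by (simp add: fs)
    show "ideal_gen (insert c I \<union> set fs') \<noteq> UNIV"
      by (rule proper) (use Suc.prems c S in \<open>auto simp: fs\<close>)
  qed
  have "\<exists>gs. set gs \<subseteq> S \<and> length gs = length fs' \<and>
      regular_sequence_quot (ideal_gen (insert c I)) gs"
  proof (rule Suc.hyps(1))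
    show "n = length fs'" using Suc.hyps(2) fs by simp
    show "ideal_gen (insert c I) \<subseteq> M"
      by (rule ideal.span_minimal[OF _ M(1)]) (use Suc.prems c S in auto)
    show "regular_sequence_quot (ideal_gen (insert c I)) fs'"
      using cfs by (simp add: regular_sequence_quot_Cons[OF I])
    show "set fs' \<subseteq> M" using Suc.prems fs by simp
  qed simp
  then obtain gs where "set gs \<subseteq> S" "length gs = length fs'"
    "regular_sequence_quot (ideal_gen (insert c I)) gs" by blast
  then have "set (c # gs) \<subseteq> S \<and> length (c # gs) = length fs \<and> regular_sequence_quot I (c # gs)"
    using c cfs fs by (auto simp: regular_sequence_quot_Cons[OF I])
  then show ?case by blast
qed

text \<open>
  The maps express that \<open>R/I'\<close>, as a module over the subring generated by \<open>S\<close>, is a direct summand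
  of a direct sum of copies of \<open>R/I\<close>; regularity of a sequence in \<open>S\<close> is inherited by summands.
\<close>

lemma regular_sequence_quot_direct_summand:
  fixes I I' :: "'a::comm_ring_1 set"
  assumes I: "ring_ideal I" and I': "ring_ideal I'"
    and \<phi>_add: "\<And>j x y. \<phi> j (x + y) = \<phi> j x + \<phi> j y"
    and \<psi>_add: "\<And>j x y. \<psi> j (x + y) = \<psi> j x + \<psi> j y"
    and \<phi>_mult: "\<And>j a x. a \<in> S \<Longrightarrow> \<phi> j (a * x) = a * \<phi> j x"
    and \<psi>_mult: "\<And>j a x. a \<in> S \<Longrightarrow> \<psi> j (a * x) = a * \<psi> j x"
    and \<phi>_ideal: "\<And>j x. x \<in> I' \<Longrightarrow> \<phi> j x \<in> I"
    and \<psi>_ideal: "\<And>j x. x \<in> I \<Longrightarrow> \<psi> j x \<in> I'"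
    and id: "\<And>x. (\<Sum>j\<in>D. \<psi> j (\<phi> j x)) = x"
    and gs: "set gs \<subseteq> S" and reg: "regular_sequence_quot I gs"
    and proper: "ideal_gen (I' \<union> set gs) \<noteq> UNIV"
  shows "regular_sequence_quot I' gs"
proof -
  have transport: "\<theta> x \<in> ideal_gen (B \<union> T)"
    if \<theta>: "\<And>x y. \<theta> (x + y) = \<theta> x + \<theta> y" "\<And>a x. a \<in> S \<Longrightarrow> \<theta> (a * x) = a * \<theta> x"
      "\<And>x. x \<in> A \<Longrightarrow> \<theta> x \<in> B" and A: "ring_ideal A" and T: "T \<subseteq> S" and x: "x \<in> ideal_gen (A \<union> T)"
    for \<theta> :: "'a \<Rightarrow> 'a" and A B T x
  proof -
    obtain a t where x: "x = a + t" "a \<in> A" "t \<in> ideal_gen T"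
      using x by (auto simp: ideal.span_Un ideal.span_eq_iff[THEN iffD2, OF A])
    have \<theta>0: "\<theta> 0 = 0" using \<theta>(1)[of 0 0] by simp
    have "\<theta> t \<in> ideal_gen (B \<union> T)"
      using x(3)
    proof (induction rule: ideal.span_induct_alt)
      case base
      then show ?case by (simp add: \<theta>0 ideal.span_zero)
    next
      case (step r s t)
      have "\<theta> (r * s) = \<theta> r * s" using \<theta>(2)[of s r] T step by (auto simp: mult.commute)
      then have "\<theta> (r * s + t) = \<theta> r * s + \<theta> t" by (simp add: \<theta>(1))
      moreover have "s \<in> B \<union> T" using step by simp
      ultimately show ?case
        using ideal.span_add[OF ideal.span_scale[OF ideal.span_base] step.IH, of s "\<theta> r"] by simp
    qed
    then show ?thesis
      using x \<theta> by (auto intro!: ideal.span_add intro: ideal.span_base)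
  qed
  have "g \<in> ideal_gen (I' \<union> set (take i gs))"
    if i: "i < length gs" and gi: "gs ! i * g \<in> ideal_gen (I' \<union> set (take i gs))" for i g
  proof -
    have T: "set (take i gs) \<subseteq> S" using gs by (meson set_take_subset subset_trans)
    have giS: "gs ! i \<in> S" using subsetD[OF gs nth_mem[OF i]] .
    have "\<psi> j (\<phi> j g) \<in> ideal_gen (I' \<union> set (take i gs))" for j
    proof (rule transport[where \<theta> = "\<psi> j", OF \<psi>_add \<psi>_mult \<psi>_ideal I T])
      have "\<phi> j (gs ! i * g) \<in> ideal_gen (I \<union> set (take i gs))"
        by (rule transport[where \<theta> = "\<phi> j", OF \<phi>_add \<phi>_mult \<phi>_ideal I' T gi])
      then show "\<phi> j g \<in> ideal_gen (I \<union> set (take i gs))"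
        using reg i by (simp add: \<phi>_mult[OF giS] regular_sequence_quot_def)
    qed
    then have "(\<Sum>j\<in>D. \<psi> j (\<phi> j g)) \<in> ideal_gen (I' \<union> set (take i gs))"
      by (rule ideal.span_sum)
    then show ?thesis by (simp add: id)
  qed
  then show ?thesis using proper by (simp add: regular_sequence_quot_def)
qed


section \<open>Monomials\<close>

abbreviation lookup :: "('a \<Rightarrow>\<^sub>0 'b::zero) \<Rightarrow> 'a \<Rightarrow> 'b" where "lookup \<equiv> Poly_Mapping.lookup"
abbreviation keys :: "('a \<Rightarrow>\<^sub>0 'b::zero) \<Rightarrow> 'a set" where "keys \<equiv> Poly_Mapping.keys"
abbreviation single :: "'a \<Rightarrow> 'b \<Rightarrow> 'a \<Rightarrow>\<^sub>0 'b::zero" where "single \<equiv> Poly_Mapping.single"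

type_synonym 'v monom = "'v \<Rightarrow>\<^sub>0 nat"

lemma monom_diff_add: "lookup a \<le> lookup b \<Longrightarrow> b - a + a = (b :: 'v monom)"
  by (rule poly_mapping_eqI) (simp add: lookup_add lookup_minus le_fun_def)

lemma monom_add_eq_0_iff: "a + b = 0 \<longleftrightarrow> a = 0 \<and> b = (0 :: 'v monom)"
  by (auto simp: poly_mapping_eq_iff fun_eq_iff lookup_add)

lemma nat_sequence_has_mono_subsequence:
  fixes t :: "nat \<Rightarrow> nat"
  shows "\<exists>r :: nat \<Rightarrow> nat. strict_mono r \<and> mono (t \<circ> r)"
proof -
  (* Choose the minimum of the tail behind the previous choice, again and again. *)
  define L where "L n = (ARG_MIN t k. n \<le> k)" for n
  have L: "n \<le> L n" "k \<ge> n \<Longrightarrow> t (L n) \<le> t k" for n k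
    using arg_min_nat_lemma[of "\<lambda>k. n \<le> k" n t] by (auto simp: L_def)
  define r where "r = rec_nat (L 0) (\<lambda>_ k. L (Suc k))"
  have r: "r 0 = L 0" "r (Suc n) = L (Suc (r n))" for n by (simp_all add: r_def)
  have "strict_mono r"
    unfolding strict_mono_Suc_iff using L(1)[of "Suc (r _)"] by (auto simp: r Suc_le_eq)
  moreover have "\<exists>b\<le>r n. r n = L b" for n
    using L(1) by (cases n) (auto simp: r)
  then have "t (r n) \<le> t (r (Suc n))" for n
    by (metis L(2) \<open>strict_mono r\<close> le_trans less_imp_le lessI strict_monoD)
  then have "mono (t \<circ> r)" by (simp add: mono_iff_le_Suc)
  ultimately show ?thesis by blast
qed

text \<open>Dickson's lemma, in the form that every sequence of monomials has a subsequence along which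
  each monomial divides the next one.\<close>

lemma monom_sequence_has_mono_subsequence:
  fixes s :: "nat \<Rightarrow> ('v::finite) monom"
  shows "\<exists>r :: nat \<Rightarrow> nat. strict_mono r \<and> mono (\<lambda>n. lookup (s (r n)))"
proof -
  have "\<exists>r :: nat \<Rightarrow> nat. strict_mono r \<and> (\<forall>v\<in>V. mono (\<lambda>n. lookup (s (r n)) v))" for V
    using finite[of V]
  proof (induction V rule: finite_induct)
    case empty
    then show ?case by (intro exI[of _ "\<lambda>n. n"]) (simp add: strict_mono_def)
  next
    case (insert v V)
    then obtain r :: "nat \<Rightarrow> nat" where r: "strict_mono r" "\<forall>v\<in>V. mono (\<lambda>n. lookup (s (r n)) v)" by blast
    obtain r' :: "nat \<Rightarrow> nat" where r': "strict_mono r'" "mono ((\<lambda>n. lookup (s (r n)) v) \<circ> r')"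
      using nat_sequence_has_mono_subsequence by blast
    have "mono (\<lambda>n. lookup (s (r (r' n))) w)" if "w \<in> V" for w
      using r(2) that strict_mono_mono[OF r'(1)] by (auto simp: mono_def)
    then show ?case
      using r' strict_mono_o[OF r(1) r'(1)] by (intro exI[of _ "r \<circ> r'"]) (auto simp: o_def)
  qed
  from this[of UNIV] show ?thesis by (auto simp: mono_def le_fun_def)
qed

text \<open>
  A monomial order, obtained by numbering the variables and comparing exponents
  lexicographically.
\<close>

definition lex_code :: "('v::finite) monom \<Rightarrow> nat \<Rightarrow>\<^sub>0 nat" where
  "lex_code a = (\<Sum>v\<in>UNIV. single ((SOME f. inj f) v) (lookup a v))"

lemma lex_code_add: "lex_code (a + b) = lex_code a + lex_code b"
  by (simp add: lex_code_def lookup_add single_add sum.distrib)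

lemma lex_code_inject: "lex_code a = lex_code b \<longleftrightarrow> a = (b :: ('v::finite) monom)"
proof -
  define idx :: "'v \<Rightarrow> nat" where "idx = (SOME f. inj f)"
  have "\<exists>f :: 'v \<Rightarrow> nat. inj f"
    using finite_imp_inj_to_nat_seg[OF finite[of "UNIV :: 'v set"]] by blast
  then have "inj idx" unfolding idx_def by (rule someI_ex)
  then have "lookup (lex_code c) (idx v) = lookup c v" for c v
    unfolding lex_code_def idx_def[symmetric]
    by (simp add: lookup_sum lookup_single when_def inj_eq)
  then show ?thesis by (metis poly_mapping_eqI)
qed

lemma lex_code_mono: "lookup a \<le> lookup b \<Longrightarrow> lex_code a \<le> lex_code (b :: ('v::finite) monom)"
proof -
  assume "lookup a \<le> lookup b"
  then have "lex_code b = lex_code (b - a) + lex_code a"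
    by (simp add: lex_code_add[symmetric] monom_diff_add)
  moreover have "\<not> lex_code (b - a) < 0"
    unfolding less_poly_mapping.rep_eq by (simp add: less_fun_def)
  ultimately show ?thesis
    using add_right_mono[of 0 "lex_code (b - a)" "lex_code a"] by (simp add: not_less)
qed

text \<open>
  By Dickson's lemma an infinite sequence has a member that divides a later one, and so does not
  exceed it.
\<close>

lemma wf_lex_code: "wf {(a, b :: ('v::finite) monom). lex_code a < lex_code b}"
proof (rule ccontr)
  assume "\<not> ?thesis"
  then obtain s :: "nat \<Rightarrow> 'v monom" where s: "\<And>i. lex_code (s (Suc i)) < lex_code (s i)"
    by (auto simp: wf_iff_no_infinite_down_chain)
  obtain r :: "nat \<Rightarrow> nat" where r: "strict_mono r" "mono (\<lambda>n. lookup (s (r n)))"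
    using monom_sequence_has_mono_subsequence by blast
  have "lex_code (s j) < lex_code (s i)" if "i < j" for i j
    using that by (induction rule: less_Suc_induct) (auto intro: s less_trans)
  then have "lex_code (s (r 1)) < lex_code (s (r 0))"
    using strict_monoD[OF r(1), of 0 1] by simp
  moreover have "lex_code (s (r 0)) \<le> lex_code (s (r 1))"
    using monoD[OF r(2), of 0 1] by (intro lex_code_mono) simp
  ultimately show False by simp
qed


section \<open>Polynomials\<close>

lemma poly_mapping_sum_single: "p = (\<Sum>m\<in>keys p. single m (lookup p m))"
  by (rule poly_mapping_eqI) (auto simp: lookup_sum lookup_single when_def in_keys_iff)

lemma lookup_times:
  "lookup (p * q) m = (\<Sum>(a, b)\<in>{(a, b). a \<in> keys p \<and> b \<in> keys q \<and> a + b = m}. lookup p a * lookup q b)"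
proof -
  have "lookup (p * q) m = (\<Sum>(a, b). lookup p a * lookup q b when m = a + b)"
    by (simp add: times_poly_mapping.rep_eq prod_fun_unfold_prod)
  also have "\<dots> = (\<Sum>(a, b)\<in>{(a, b). a \<in> keys p \<and> b \<in> keys q \<and> a + b = m}.
      (lookup p a * lookup q b when m = a + b))"
    by (rule Sum_any.expand_superset)
      (auto simp: in_keys_iff intro: finite_subset[of _ "keys p \<times> keys q"])
  also have "\<dots> = (\<Sum>(a, b)\<in>{(a, b). a \<in> keys p \<and> b \<in> keys q \<and> a + b = m}. lookup p a * lookup q b)"
    by (rule sum.cong) auto
  finally show ?thesis .
qed

lemma lookup_single_times:
  fixes p :: "('v, 'k::comm_ring_1) mpoly"
  shows "lookup (single u c * p) m = (if lookup u \<le> lookup m then c * lookup p (m - u) else 0)"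
proof -
  have "lookup (single u c * p) m
      = (\<Sum>(a, b)\<in>{(a, b). a \<in> keys (single u c) \<and> b \<in> keys p \<and> a + b = m}.
          lookup (single u c) a * lookup p b)"
    by (rule lookup_times)
  also have "{(a, b). a \<in> keys (single u c) \<and> b \<in> keys p \<and> a + b = m}
      = (if c \<noteq> 0 \<and> lookup u \<le> lookup m \<and> m - u \<in> keys p then {(u, m - u)} else {})"
    by (auto simp: monom_diff_add add.commute[of u] le_fun_def lookup_add)
  finally show ?thesis by (auto simp: in_keys_iff)
qed

lemma lookup_times_0:
  "lookup (p * q) 0 = lookup p 0 * lookup q (0 :: 'v monom)"
proof -
  have eq: "{(a, b). a \<in> keys p \<and> b \<in> keys q \<and> a + b = 0}
      = (if 0 \<in> keys p \<and> 0 \<in> keys q then {(0, 0)} else {})"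
    by (auto simp: monom_add_eq_0_iff)
  show ?thesis unfolding lookup_times eq by (auto simp: in_keys_iff)
qed

text \<open>
  The product of the leading terms of two nonzero polynomials does not cancel; it is enough
  to compare with the terms that contribute to the same monomial.
\<close>

lemma lookup_times_leading:
  fixes p q :: "('v::finite, 'k::comm_ring_1) mpoly"
  assumes "a \<in> keys p" "b \<in> keys q"
    and "\<And>a' b'. a' \<in> keys p \<Longrightarrow> b' \<in> keys q \<Longrightarrow> a' + b' = a + b \<Longrightarrow>
           lex_code a' \<le> lex_code a \<and> lex_code b' \<le> lex_code b"
  shows "lookup (p * q) (a + b) = lookup p a * lookup q b"
proof -
  have "a' = a \<and> b' = b" if "a' \<in> keys p" "b' \<in> keys q" "a' + b' = a + b" for a' b'
  proof -
    have "lex_code a' + lex_code b' = lex_code a + lex_code b"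
      using that(3) by (simp flip: lex_code_add)
    moreover have "lex_code a' \<le> lex_code a" "lex_code b' \<le> lex_code b"
      using assms(3)[OF that] by auto
    ultimately have "lex_code a' = lex_code a" "lex_code b' = lex_code b"
      by (metis add_less_le_mono add_le_less_mono less_le order_less_irrefl)+
    then show ?thesis by (simp add: lex_code_inject)
  qed
  then have "{(a', b'). a' \<in> keys p \<and> b' \<in> keys q \<and> a' + b' = a + b} = {(a, b)}"
    using assms(1,2) by auto
  then show ?thesis by (simp add: lookup_times)
qed

definition leading_monom :: "('v::finite, 'k::zero) mpoly \<Rightarrow> 'v monom" where
  "leading_monom p = (SOME m. m \<in> keys p \<and> (\<forall>m'\<in>keys p. lex_code m' \<le> lex_code m))"

lemma finite_monom_set_has_leading:
  assumes "finite M" and "M \<noteq> {}"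
  shows "\<exists>m\<in>M. \<forall>m'\<in>M. lex_code m' \<le> lex_code (m :: ('v::finite) monom)"
proof -
  have "Max (lex_code ` M) \<in> lex_code ` M" using assms by (intro Max_in) auto
  then show ?thesis using assms(1) by (auto intro!: bexI Max_ge simp: image_iff) (metis Max_ge finite_imageI imageI)
qed

lemma leading_monom:
  assumes "p \<noteq> 0"
  shows "leading_monom p \<in> keys p" and "m \<in> keys p \<Longrightarrow> lex_code m \<le> lex_code (leading_monom p)"
proof -
  have "\<exists>m. m \<in> keys p \<and> (\<forall>m'\<in>keys p. lex_code m' \<le> lex_code m)"
    using finite_monom_set_has_leading[of "keys p"] assms by auto
  from someI_ex[OF this] show "leading_monom p \<in> keys p"
    "m \<in> keys p \<Longrightarrow> lex_code m \<le> lex_code (leading_monom p)"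
    unfolding leading_monom_def by auto
qed

text \<open>
  Hilbert's basis theorem: in a strictly increasing chain of ideals choose for each step a new
  element with smallest possible leading monomial. By Dickson's lemma one of these leading
  monomials divides a later one, and reducing the later element gives a new one with a
  smaller leading monomial.
\<close>

theorem noetherian_mpoly: "noetherian_ring_type TYPE(('v::finite, 'k::field) mpoly)"
proof (rule ccontr)
  assume "\<not> ?thesis"
  then obtain f :: "nat \<Rightarrow> ('v, 'k) mpoly set"
    where f: "\<And>i. (f (Suc i), f i) \<in> {(J, I). ring_ideal I \<and> ring_ideal J \<and> I \<subset> J}"
    unfolding noetherian_ring_type_def wf_iff_no_infinite_down_chain by blast
  have ideal: "ring_ideal (f i)" and chain: "f i \<subset> f (Suc i)" for i
    using f[of i] by auto
  have mono: "f i \<subseteq> f j" if "i \<le> j" for i j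
    using lift_Suc_mono_le[of f, OF _ that] chain by blast
  have "\<exists>p. p \<in> f (Suc i) - f i \<and>
      (\<forall>q\<in>f (Suc i) - f i. \<not> lex_code (leading_monom q) < lex_code (leading_monom p))" for i
  proof -
    have ne: "leading_monom ` (f (Suc i) - f i) \<noteq> {}" using chain[of i] by auto
    obtain m where "m \<in> leading_monom ` (f (Suc i) - f i)"
      "\<forall>m'. lex_code m' < lex_code m \<longrightarrow> m' \<notin> leading_monom ` (f (Suc i) - f i)"
      using wf_lex_code ne unfolding wf_eq_minimal by (metis (mono_tags, lifting) case_prodI ex_in_conv mem_Collect_eq)
    then show ?thesis by blast
  qed
  then obtain p where p: "\<And>i. p i \<in> f (Suc i) - f i"
    and min: "\<And>i q. q \<in> f (Suc i) - f i \<Longrightarrow>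
      \<not> lex_code (leading_monom q) < lex_code (leading_monom (p i))"
    by metis
  have nz: "p i \<noteq> 0" for i using p[of i] ideal.subspace_0[OF ideal] by auto
  obtain r :: "nat \<Rightarrow> nat" where r: "strict_mono r" "mono (\<lambda>n. lookup (leading_monom (p (r n))))"
    using monom_sequence_has_mono_subsequence[of "\<lambda>n. leading_monom (p n)"] by blast
  define i j where "i = r 0" and "j = r 1"
  have ij: "i < j" using strict_monoD[OF r(1), of 0 1] by (simp add: i_def j_def)
  define a b where "a = leading_monom (p i)" and "b = leading_monom (p j)"
  have ab: "lookup a \<le> lookup b"
    using monoD[OF r(2), of 0 1] by (simp add: a_def b_def i_def j_def)
  have a: "a \<in> keys (p i)" and b: "b \<in> keys (p j)"
    unfolding a_def b_def by (rule leading_monom(1)[OF nz])+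
  define t where "t = single (b - a) (lookup (p j) b / lookup (p i) a)"
  define q where "q = p j - t * p i"
  have tpi: "t * p i \<in> f j"
    using ideal.subspace_scale[OF ideal] p[of i] mono[of "Suc i" j] ij by auto
  have "q \<in> f (Suc j)"
    unfolding q_def using p[of j] tpi mono[of j "Suc j"] by (intro ideal.subspace_diff[OF ideal]) auto
  moreover have "q \<notin> f j"
    using ideal.subspace_add[OF ideal _ tpi, of q] p[of j] by (auto simp: q_def)
  ultimately have qD: "q \<in> f (Suc j) - f j" by simp
  then have "q \<noteq> 0" using ideal.subspace_0[OF ideal] by auto
  have "lookup q b = 0"
  proof -
    have "b - (b - a) = a"
      using ab by (intro poly_mapping_eqI) (simp add: lookup_minus le_fun_def)
    moreover have "lookup (b - a) \<le> lookup b" by (simp add: le_fun_def lookup_minus)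
    ultimately show ?thesis
      using a by (simp add: q_def t_def lookup_minus lookup_single_times in_keys_iff)
  qed
  have "lex_code m < lex_code b" if m: "m \<in> keys q" for m
  proof -
    have "m \<noteq> b" using m \<open>lookup q b = 0\<close> by (auto simp: in_keys_iff)
    moreover have "lex_code m \<le> lex_code b"
    proof (cases "m \<in> keys (p j)")
      case True
      then show ?thesis unfolding b_def by (rule leading_monom(2)[OF nz])
    next
      case False
      then have "m \<in> keys (t * p i)" using m by (auto simp: q_def in_keys_iff lookup_minus)
      then obtain m' where m': "m' \<in> keys (p i)" "m = (b - a) + m'"
        using keys_mult[of t "p i"] by (auto simp: t_def split: if_splits)
      have "lex_code m \<le> lex_code (b - a) + lex_code a"
        using leading_monom(2)[OF nz m'(1)] by (simp add: m'(2) lex_code_add a_def)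
      then show ?thesis by (simp add: lex_code_add[symmetric] monom_diff_add[OF ab])
    qed
    ultimately show ?thesis by (simp add: less_le lex_code_inject)
  qed
  then have "lex_code (leading_monom q) < lex_code b" using leading_monom(1)[OF \<open>q \<noteq> 0\<close>] by blast
  then show False using min[OF qD] by (simp add: b_def)
qed


section \<open>Monomial ideals\<close>

definition mon_ideal :: "'v monom set \<Rightarrow> ('v, 'k::comm_ring_1) mpoly set" where
  "mon_ideal U = {p. keys p \<subseteq> U}"

definition upset :: "'v monom set \<Rightarrow> bool" where
  "upset U \<longleftrightarrow> (\<forall>a\<in>U. \<forall>b. a + b \<in> U)"

lemma upsetD: "upset U \<Longrightarrow> a \<in> U \<Longrightarrow> lookup a \<le> lookup b \<Longrightarrow> b \<in> U"
  unfolding upset_def by (metis add.commute monom_diff_add)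

lemma ring_ideal_mon_ideal:
  assumes "upset U"
  shows "ring_ideal (mon_ideal U :: ('v, 'k::comm_ring_1) mpoly set)"
proof (rule ideal.subspaceI)
  fix x y c :: "('v, 'k) mpoly"
  assume x: "x \<in> mon_ideal U"
  show "x + y \<in> mon_ideal U" if "y \<in> mon_ideal U"
    using keys_add[of x y] x that by (auto simp: mon_ideal_def)
  show "c * x \<in> mon_ideal U"
    using keys_mult[of c x] x assms by (force simp: mon_ideal_def upset_def add.commute)
qed (simp add: mon_ideal_def)

lemma mon_ideal_subset_ideal:
  assumes "ring_ideal I" and "\<And>m. m \<in> U \<Longrightarrow> single m 1 \<in> (I :: ('v, 'k::comm_ring_1) mpoly set)"
  shows "mon_ideal U \<subseteq> I"
proof
  fix p :: "('v, 'k) mpoly" assume "p \<in> mon_ideal U"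
  have "single m c \<in> I" if "m \<in> U" for m c
    using ideal.subspace_scale[OF assms(1) assms(2)[OF that], of "single 0 c"] by (simp add: mult_single)
  then have "(\<Sum>m\<in>keys p. single m (lookup p m)) \<in> I"
    using \<open>p \<in> mon_ideal U\<close> by (intro ideal.subspace_sum[OF assms(1)]) (auto simp: mon_ideal_def)
  then show "p \<in> I" by (simp flip: poly_mapping_sum_single)
qed

lemma single_in_mon_ideal_iff: "single m c \<in> mon_ideal U \<longleftrightarrow> c = 0 \<or> m \<in> U"
  by (simp add: mon_ideal_def)

lemma mon_ideal_ne_UNIV_iff:
  "upset U \<Longrightarrow> (mon_ideal U :: ('v, 'k::comm_ring_1) mpoly set) \<noteq> UNIV \<longleftrightarrow> 0 \<notin> U"
  using ideal_one_iff[OF ring_ideal_mon_ideal, of U] by (auto simp: mon_ideal_def)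

lemma graded_maximal_ideal_eq:
  "graded_maximal_ideal = (mon_ideal (- {0}) :: ('v, 'k::comm_ring_1) mpoly set)"
proof
  have single_ne: "single v (1::nat) \<noteq> 0" for v :: 'v
    by (metis lookup_single_eq lookup_zero zero_neq_one)
  have up: "upset (- {0} :: 'v monom set)" by (auto simp: upset_def monom_add_eq_0_iff)
  show "graded_maximal_ideal \<subseteq> (mon_ideal (- {0}) :: ('v, 'k) mpoly set)"
    unfolding graded_maximal_ideal_def
  proof (rule ideal.span_minimal[OF _ ring_ideal_mon_ideal[OF up]])
    show "Set.range indet \<subseteq> (mon_ideal (- {0}) :: ('v, 'k) mpoly set)"
      using single_ne by (auto simp: indet_def single_in_mon_ideal_iff)
  qed
  show "mon_ideal (- {0}) \<subseteq> (graded_maximal_ideal :: ('v, 'k) mpoly set)"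
  proof (rule mon_ideal_subset_ideal)
    fix m :: "'v monom" assume "m \<in> - {0}"
    then obtain v where v: "lookup m v \<noteq> 0" by (metis Compl_iff lookup_zero poly_mapping_eqI singletonI)
    have "lookup (single v 1) \<le> lookup m" using v by (auto simp: le_fun_def lookup_single when_def)
    then have "single m 1 = single (m - single v 1) 1 * (indet v :: ('v, 'k) mpoly)"
      by (simp add: indet_def mult_single monom_diff_add)
    then show "single m 1 \<in> (graded_maximal_ideal :: ('v, 'k) mpoly set)"
      unfolding graded_maximal_ideal_def by (auto intro: ideal.span_scale ideal.span_base)
  qed (simp add: graded_maximal_ideal_def)
qed

lemma in_graded_maximal_ideal_iff: "p \<in> graded_maximal_ideal \<longleftrightarrow> lookup p 0 = 0"
  by (auto simp: graded_maximal_ideal_eq mon_ideal_def in_keys_iff)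

lemma ring_ideal_graded_maximal_ideal: "ring_ideal graded_maximal_ideal"
  by (simp add: graded_maximal_ideal_def)

lemma indet_power: "indet v ^ n = single (single v n) (1 :: 'k::comm_ring_1)"
  by (induction n) (simp_all add: indet_def mult_single flip: single_add)

definition cap :: "nat \<Rightarrow> ('v::finite) monom \<Rightarrow> 'v monom" where
  "cap N m = Abs_poly_mapping (\<lambda>v. min (lookup m v) N)"

lemma lookup_cap [simp]: "lookup (cap N m) v = min (lookup m v) N"
  by (simp add: cap_def)

lemma finite_bounded_monoms: "finite {m :: ('v::finite) monom. \<forall>v. lookup m v \<le> N}"
proof (rule finite_subset)
  show "{m :: 'v monom. \<forall>v. lookup m v \<le> N} \<subseteq> Abs_poly_mapping ` (PiE UNIV (\<lambda>_. {..N}))"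
    by (auto simp: image_iff PiE_def Pi_def) (metis lookup_inverse)
  show "finite (Abs_poly_mapping ` (PiE UNIV (\<lambda>_ :: 'v. {..N})))"
    by (intro finite_imageI finite_PiE) auto
qed

text \<open>
  If every \<open>N\<close> had a counterexample \<open>m\<^sub>N\<close>, then by Dickson's lemma infinitely many of them would be
  multiples of one \<open>m\<^sub>i \<in> U\<close>; for large \<open>N\<close> so is the truncation of \<open>m\<^sub>N\<close>, which therefore lies in \<open>U\<close>.
\<close>

lemma upset_bounded:
  fixes U :: "('v::finite) monom set"
  assumes "upset U"
  shows "\<exists>N. \<forall>m\<in>U. cap N m \<in> U"
proof (rule ccontr)
  assume "\<not> ?thesis"
  then have "\<exists>m. m \<in> U \<and> cap N m \<notin> U" for N by blast
  then obtain s where s: "\<And>N. s N \<in> U" "\<And>N. cap N (s N) \<notin> U" by metis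
  obtain r :: "nat \<Rightarrow> nat" where r: "strict_mono r" "mono (\<lambda>n. lookup (s (r n)))"
    using monom_sequence_has_mono_subsequence by blast
  define n where "n = Max (Set.range (lookup (s (r 0))))"
  have "lookup (s (r 0)) \<le> lookup (cap (r n) (s (r n)))"
  proof (rule le_funI)
    fix v
    have "lookup (s (r 0)) v \<le> n" by (simp add: n_def)
    also have "n \<le> r n" by (rule strict_mono_imp_increasing[OF r(1)])
    finally show "lookup (s (r 0)) v \<le> lookup (cap (r n) (s (r n))) v"
      using monoD[OF r(2), of 0 n] by (simp add: le_fun_def)
  qed
  then show False using upsetD[OF assms s(1)] s(2) by blast
qed


section \<open>Depth of colon ideals\<close>

text \<open>
  The polynomials in the \<open>N\<close>-th powers of the variables form a subring, over which the
  polynomial ring is the direct sum of the pieces spanned by the monomials with a given residue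
  vector modulo \<open>N\<close>.
\<close>

definition power_poly :: "nat \<Rightarrow> ('v, 'k::comm_ring_1) mpoly \<Rightarrow> bool" where
  "power_poly N p \<longleftrightarrow> (\<forall>m\<in>keys p. \<forall>v. N dvd lookup m v)"

definition residue :: "nat \<Rightarrow> 'v monom \<Rightarrow> 'v \<Rightarrow> nat" where
  "residue N m v = lookup m v mod N"

text \<open>
  Replaces the piece of residue \<open>b\<close> by the piece of residue \<open>a\<close>, and drops all other ones:
  \<open>x\<^sup>b p \<mapsto> x\<^sup>a p\<close> for a polynomial \<open>p\<close> in the \<open>N\<close>-th powers of the variables.
\<close>

definition change_residue ::
    "nat \<Rightarrow> 'v monom \<Rightarrow> 'v monom \<Rightarrow> ('v, 'k::comm_ring_1) mpoly \<Rightarrow> ('v, 'k) mpoly" where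
  "change_residue N b a p =
     Abs_poly_mapping (\<lambda>m. if residue N m = lookup a then lookup p (m - a + b) else 0)"

lemma residue_le: "residue N m = lookup a \<Longrightarrow> lookup a \<le> lookup m"
  by (auto simp: le_fun_def residue_def fun_eq_iff) (metis mod_less_eq_dividend)

lemma lookup_change_residue:
  "lookup (change_residue N b a p) m = (if residue N m = lookup a then lookup p (m - a + b) else 0)"
proof -
  have "{m. (if residue N m = lookup a then lookup p (m - a + b) else 0) \<noteq> 0}
      \<subseteq> (\<lambda>m'. m' - b + a) ` keys p"
  proof
    fix m assume "m \<in> {m. (if residue N m = lookup a then lookup p (m - a + b) else 0) \<noteq> 0}"
    then have "residue N m = lookup a" "m - a + b \<in> keys p" by (auto simp: in_keys_iff split: if_splits)
    moreover have "m = (m - a + b) - b + a"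
      using monom_diff_add[OF residue_le[OF \<open>residue N m = lookup a\<close>]] by simp
    ultimately show "m \<in> (\<lambda>m'. m' - b + a) ` keys p" by blast
  qed
  then have "finite {m. (if residue N m = lookup a then lookup p (m - a + b) else 0) \<noteq> 0}"
    by (rule finite_subset) simp
  then show ?thesis by (simp add: change_residue_def)
qed

lemma change_residue_add:
  "change_residue N b a (p + q) = change_residue N b a p + change_residue N b a q"
  by (rule poly_mapping_eqI) (simp add: lookup_add lookup_change_residue)

lemma change_residue_change_residue:
  assumes "\<And>v. lookup a v < N" and "\<And>v. lookup b v < N"
  shows "lookup (change_residue N a b (change_residue N b a p)) m
      = (if residue N m = lookup b then lookup p m else 0)"
proof (cases "residue N m = lookup b")
  case True
  note m = monom_diff_add[OF residue_le[OF True]]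
  have "residue N (m - b + a) = lookup a"
  proof
    fix v
    have "(lookup m v - lookup b v) mod N = 0"
      using True unfolding residue_def fun_eq_iff by (metis minus_mod_eq_mult_div mod_mult_self1_is_0)
    then show "residue N (m - b + a) v = lookup a v"
      using assms(1)[of v] by (simp add: residue_def lookup_add lookup_minus mod_add_left_eq[symmetric, of "_ - _"] del: mod_add_left_eq)
  qed
  then show ?thesis using True m by (simp add: lookup_change_residue)
qed (simp add: lookup_change_residue)

lemma residue_cancel:
  assumes "N dvd u" and "a < N" and "b < N" and "x mod N = (a::nat)"
  shows "u \<le> x - a + b \<longleftrightarrow> u \<le> x" and "u \<le> x \<Longrightarrow> x - u - a + b = x - a + b - u"
proof -
  obtain s where u: "u = N * s" using assms(1) by auto
  have x: "x = N * (x div N) + a" using assms(4) by (metis mult_div_mod_eq)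
  have "N * s \<le> N * q + r \<longleftrightarrow> s \<le> q" if "r < N" for q r
  proof
    assume "N * s \<le> N * q + r"
    then have "N * s div N \<le> (N * q + r) div N" by (rule div_le_mono)
    then show "s \<le> q" using that by simp
  qed (simp add: trans_le_add1)
  note cancel = this[OF assms(2), of "x div N"] this[OF assms(3), of "x div N"]
  have xa: "x - a = N * (x div N)" by (metis x add_diff_cancel_right')
  have *: "u \<le> x \<longleftrightarrow> s \<le> x div N" "u \<le> x - a + b \<longleftrightarrow> s \<le> x div N"
    using cancel unfolding x[symmetric] xa u by auto
  then show "u \<le> x - a + b \<longleftrightarrow> u \<le> x" by simp
  have "u \<le> x - a" if "u \<le> x" unfolding u xa using that * by (intro mult_le_mono2) simp
  then show "x - u - a + b = x - a + b - u" if "u \<le> x"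
    using that x by simp
qed

text \<open>
  Whether a product of \<open>N\<close>-th powers divides a monomial does not depend on the residue vector of the
  monomial, which makes the change of residue linear over such products.
\<close>

lemma change_residue_single_times:
  assumes u: "\<And>v. N dvd lookup u v" and a: "\<And>v. lookup a v < N" and b: "\<And>v. lookup b v < N"
  shows "change_residue N b a (single u c * p) = single u c * change_residue N b a p"
proof (rule poly_mapping_eqI)
  fix m
  have res: "residue N (m - u) = residue N m" if "lookup u \<le> lookup m"
  proof
    fix v
    show "residue N (m - u) v = residue N m v"
      using that u[of v] by (auto simp: residue_def lookup_minus le_fun_def elim!: dvdE)
        (metis add_diff_inverse_nat linorder_not_less mod_mult_self2 add.commute)
  qed
  show "lookup (change_residue N b a (single u c * p)) m = lookup (single u c * change_residue N b a p) m"
  proof (cases "residue N m = lookup a")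
    case True
    then have m: "lookup m v mod N = lookup a v" for v by (metis residue_def)
    have "lookup u \<le> lookup (m - a + b) \<longleftrightarrow> lookup u \<le> lookup m" 
      using residue_cancel(1)[OF u a b m] by (simp add: le_fun_def lookup_add lookup_minus)
    moreover have "m - u - a + b = m - a + b - u" if "lookup u \<le> lookup m"
      using residue_cancel(2)[OF u a b m] that
      by (intro poly_mapping_eqI) (simp add: le_fun_def lookup_add lookup_minus)
    ultimately show ?thesis
      using True res by (simp add: lookup_change_residue lookup_single_times)
  next
    case False
    then show ?thesis using res by (simp add: lookup_change_residue lookup_single_times)
  qed
qed

lemma change_residue_times:
  assumes p: "power_poly N p" and a: "\<And>v. lookup a v < N" and b: "\<And>v. lookup b v < N"
  shows "change_residue N b a (p * q) = p * change_residue N b a q"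
proof -
  have zero: "change_residue N b a 0 = 0"
    by (rule poly_mapping_eqI) (simp add: lookup_change_residue)
  have sum: "change_residue N b a (\<Sum>i\<in>A. f i) = (\<Sum>i\<in>A. change_residue N b a (f i))"
    if "finite A" for A :: "'a monom set" and f
    using that by (induction A rule: finite_induct) (simp_all add: zero change_residue_add)
  have "change_residue N b a (p * q)
      = change_residue N b a (\<Sum>m\<in>keys p. single m (lookup p m) * q)"
    by (simp only: sum_distrib_right[symmetric] poly_mapping_sum_single[symmetric])
  also have "\<dots> = (\<Sum>m\<in>keys p. single m (lookup p m) * change_residue N b a q)"
    using p a b by (simp add: sum power_poly_def change_residue_single_times)
  also have "\<dots> = p * change_residue N b a q"
    by (simp only: sum_distrib_right[symmetric] poly_mapping_sum_single[symmetric])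
  finally show ?thesis .
qed

definition colon :: "'v monom set \<Rightarrow> 'v monom \<Rightarrow> 'v monom set" where
  "colon U c = {m. m + c \<in> U}"

lemma upset_colon: "upset U \<Longrightarrow> upset (colon U c)"
  unfolding upset_def colon_def by (metis add.assoc add.commute mem_Collect_eq)

text \<open>
  If \<open>I\<close> is generated in exponents below \<open>N\<close>, then the piece of residue \<open>r\<close> of \<open>R/(I : x\<^sup>c)\<close> is
  isomorphic to the piece of residue \<open>min (r + c) (N - 1)\<close> of \<open>R/I\<close>: the exponents \<open>N - 1\<close> and
  above cannot be told apart by \<open>I\<close>. Hence \<open>R/(I : x\<^sup>c)\<close> is a direct summand of copies of \<open>R/I\<close> over
  the polynomials in the \<open>N\<close>-th powers, and by exchange regular sequences may be taken there.
\<close>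

theorem depth_quot_colon:
  fixes U :: "('v::finite) monom set"
  assumes U: "upset U" and c: "c \<notin> U"
  shows "depth_quot (mon_ideal U :: ('v, 'k::field) mpoly set) \<le> depth_quot (mon_ideal (colon U c) :: ('v, 'k) mpoly set)"
proof -
  let ?I = "mon_ideal U :: ('v, 'k) mpoly set"
  let ?I' = "mon_ideal (colon U c) :: ('v, 'k) mpoly set"
  let ?M = "graded_maximal_ideal :: ('v, 'k) mpoly set"
  obtain N0 where N0: "\<And>m. m \<in> U \<Longrightarrow> cap N0 m \<in> U" using upset_bounded[OF U] by blast
  define N where "N = Suc N0"
  define S :: "('v, 'k) mpoly set" where "S = {p. power_poly N p \<and> lookup p 0 = 0}"
  have M: "ring_ideal ?M" by (rule ring_ideal_graded_maximal_ideal)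
  have Mne: "?M \<noteq> UNIV" using in_graded_maximal_ideal_iff[of 1] by auto
  have I: "ring_ideal ?I" and I': "ring_ideal ?I'"
    using U by (auto intro: ring_ideal_mon_ideal upset_colon)
  have sub: "?I \<subseteq> ?M" "?I' \<subseteq> ?M"
    using upsetD[OF U _, of 0 c] c
    by (auto simp: mon_ideal_def graded_maximal_ideal_eq colon_def le_fun_def)
  have SM: "S \<subseteq> ?M" by (auto simp: S_def in_graded_maximal_ideal_iff)
  have S_add: "p + q \<in> S" if "p \<in> S" "q \<in> S" for p q
    using that keys_add[of p q] by (auto simp: S_def power_poly_def lookup_add)
  have S_mult: "p * q \<in> S" if "p \<in> S" "q \<in> S" for p q
    using that keys_mult[of p q] by (fastforce simp: S_def power_poly_def lookup_add lookup_times_0)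
  have power_in_S: "indet v ^ N \<in> S" for v
  proof -
    have "single v N \<noteq> 0" by (metis N_def Zero_not_Suc lookup_single_eq lookup_zero)
    then show ?thesis
      by (auto simp: S_def indet_power power_poly_def lookup_single when_def)
  qed
  have prime: "?M \<subseteq> P" if P: "prime_ideal P" and SP: "S \<subseteq> P" for P
  proof -
    have "x \<in> P" if "x ^ n \<in> P" for x n
      using that
    proof (induction n)
      case 0
      then show ?case using P by (auto simp: prime_ideal_def ideal_one_iff)
    next
      case (Suc n)
      then show ?case using P by (auto simp: prime_ideal_def)
    qed
    then have "indet v \<in> P" for v using power_in_S[of v] SP by blast
    then show ?thesis
      unfolding graded_maximal_ideal_def using P
      by (intro ideal.span_minimal) (auto simp: prime_ideal_def)
  qed
  have "enat (length fs) \<le> depth_quot ?I'"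
    if fs: "set fs \<subseteq> ?M" "regular_sequence_quot ?I fs" for fs
  proof -
    obtain gs where gs: "set gs \<subseteq> S" "length gs = length fs" "regular_sequence_quot ?I gs"
      using regular_sequence_quot_exchange[OF noetherian_mpoly M Mne SM _ S_add S_mult prime I sub(1) fs(2,1)]
        power_in_S by blast
    define D where "D = {r :: 'v monom. \<forall>v. lookup r v < N}"
    define t where "t r = cap N0 (r + c)" for r
    have tN: "lookup (t r) v < N" for r v by (simp add: t_def N_def less_Suc_eq_le)
    (* Indices outside D are sent to 0, so that the maps are linear for every index. *)
    define \<rho> where "\<rho> j = (if j \<in> D then j else 0)" for j
    have \<rho>N: "lookup (\<rho> j) v < N" for j v by (auto simp: \<rho>_def D_def N_def)
    have U_iff: "w + t r \<in> U \<longleftrightarrow> w + r + c \<in> U"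
      if w: "\<And>v. N dvd lookup w v" for w r
    proof
      assume "w + t r \<in> U"
      then show "w + r + c \<in> U"
        by (rule upsetD[OF U]) (simp add: t_def le_fun_def lookup_add)
    next
      assume "w + r + c \<in> U"
      then have "cap N0 (w + r + c) \<in> U" by (rule N0)
      then show "w + t r \<in> U"
        by (rule upsetD[OF U]) (use w in \<open>auto simp: t_def le_fun_def lookup_add N_def elim!: dvdE\<close>)
    qed
    have shift: "\<And>v. N dvd lookup (m - a) v" if "residue N m = lookup a" for m a
      using that by (auto simp: residue_def lookup_minus fun_eq_iff) (metis dvd_minus_mod)
    have "regular_sequence_quot ?I' gs"
    proof (rule regular_sequence_quot_direct_summand[OF I I', where
          \<phi> = "\<lambda>j. change_residue N (\<rho> j) (t (\<rho> j))" and \<psi> = "\<lambda>j. change_residue N (t (\<rho> j)) (\<rho> j)"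
          and S = S and D = D])
      show "change_residue N (\<rho> j) (t (\<rho> j)) x \<in> ?I" if "x \<in> ?I'" for j x
      proof -
        have "m \<in> U" if m: "lookup (change_residue N (\<rho> j) (t (\<rho> j)) x) m \<noteq> 0" for m
        proof -
          have r: "residue N m = lookup (t (\<rho> j))" and k: "m - t (\<rho> j) + \<rho> j \<in> keys x"
            using m by (auto simp: lookup_change_residue in_keys_iff split: if_splits)
          have "m - t (\<rho> j) + \<rho> j + c \<in> U"
            using k \<open>x \<in> ?I'\<close> by (auto simp: mon_ideal_def colon_def)
          then show ?thesis
            using U_iff[OF shift[OF r], of "\<rho> j"] monom_diff_add[OF residue_le[OF r]] by simp
        qed
        then show ?thesis by (auto simp: mon_ideal_def in_keys_iff)
      qed
      show "change_residue N (t (\<rho> j)) (\<rho> j) x \<in> ?I'" if "x \<in> ?I" for j x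
      proof -
        have "m + c \<in> U" if m: "lookup (change_residue N (t (\<rho> j)) (\<rho> j) x) m \<noteq> 0" for m
        proof -
          have r: "residue N m = lookup (\<rho> j)" and k: "m - \<rho> j + t (\<rho> j) \<in> keys x"
            using m by (auto simp: lookup_change_residue in_keys_iff split: if_splits)
          have "m - \<rho> j + t (\<rho> j) \<in> U"
            using k \<open>x \<in> ?I\<close> by (auto simp: mon_ideal_def)
          then show ?thesis
            using U_iff[OF shift[OF r], of "\<rho> j"] monom_diff_add[OF residue_le[OF r]] by simp
        qed
        then show ?thesis by (auto simp: mon_ideal_def colon_def in_keys_iff)
      qed
      show "(\<Sum>j\<in>D. change_residue N (t (\<rho> j)) (\<rho> j) (change_residue N (\<rho> j) (t (\<rho> j)) x)) = x"
        for x :: "('v, 'k) mpoly"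
      proof (rule poly_mapping_eqI)
        fix m :: "'v monom"
        define r where "r = Abs_poly_mapping (residue N m)"
        have r: "lookup r = residue N m" by (simp add: r_def)
        then have rD: "r \<in> D" by (simp add: D_def residue_def N_def)
        have "finite D" using finite_bounded_monoms[of N0] by (simp add: D_def N_def less_Suc_eq_le)
        have "lookup (\<Sum>j\<in>D. change_residue N (t (\<rho> j)) (\<rho> j) (change_residue N (\<rho> j) (t (\<rho> j)) x)) m
            = (\<Sum>j\<in>D. if j = r then lookup x m else 0)"
          unfolding lookup_sum
        proof (rule sum.cong)
          fix j assume "j \<in> D"
          then have "residue N m = lookup (\<rho> j) \<longleftrightarrow> j = r" by (metis \<rho>_def r lookup_inject)
          then show "lookup (change_residue N (t (\<rho> j)) (\<rho> j) (change_residue N (\<rho> j) (t (\<rho> j)) x)) m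
              = (if j = r then lookup x m else 0)"
            by (simp add: change_residue_change_residue[OF tN \<rho>N])
        qed simp
        then show "lookup (\<Sum>j\<in>D. change_residue N (t (\<rho> j)) (\<rho> j) (change_residue N (\<rho> j) (t (\<rho> j)) x)) m = lookup x m"
          using \<open>finite D\<close> rD by simp
      qed
      have "ideal_gen (?I' \<union> set gs) \<subseteq> ?M"
        by (rule ideal.span_minimal[OF _ M]) (use sub(2) gs(1) SM in auto)
      then show "ideal_gen (?I' \<union> set gs) \<noteq> UNIV" using Mne by auto
    qed (use gs in \<open>auto simp: S_def change_residue_add change_residue_times tN \<rho>N\<close>)
    then show ?thesis
      unfolding depth_quot_def using gs SM by (intro SUP_upper2[of gs]) auto
  qed
  then show ?thesis
    unfolding depth_quot_def[of ?I] by (intro SUP_least) auto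
qed


section \<open>Symbolic powers of the ideal of covers\<close>

(* Keeps degree_ge e 1 in the form in which the lemmas state it. *)
declare One_nat_def [simp del]

definition set_monom :: "('v::finite) set \<Rightarrow> 'v monom" where
  "set_monom C = (\<Sum>v\<in>C. single v 1)"

lemma lookup_set_monom: "lookup (set_monom C) v = (if v \<in> C then 1 else 0)"
  by (simp add: set_monom_def lookup_sum lookup_single when_def)

lemma prod_indet: "(\<Prod>v\<in>C. indet v) = (single (set_monom C) 1 :: ('v::finite, 'k::comm_ring_1) mpoly)"
  using finite[of C]
  by (induction C rule: finite_induct) (simp_all add: set_monom_def indet_def mult_single)

definition degree_ge :: "('v::finite) set \<Rightarrow> nat \<Rightarrow> 'v monom set" where
  "degree_ge e k = {m. k \<le> (\<Sum>v\<in>e. lookup m v)}"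

definition cover_upset :: "('v::finite) set set \<Rightarrow> nat \<Rightarrow> 'v monom set" where
  "cover_upset H k = (\<Inter>e\<in>H. degree_ge e k)"

lemma upset_degree_ge: "upset (degree_ge e k)"
  by (auto simp: upset_def degree_ge_def lookup_add sum.distrib)

lemma upset_cover_upset: "upset (cover_upset H k)"
  using upset_degree_ge by (auto simp: upset_def cover_upset_def)

lemma mon_ideal_cover_upset: "mon_ideal (cover_upset H k) = (\<Inter>e\<in>H. mon_ideal (degree_ge e k))"
  by (auto simp: mon_ideal_def cover_upset_def)

lemma degree_ge_one_iff: "m \<in> degree_ge e 1 \<longleftrightarrow> keys m \<inter> e \<noteq> {}"
proof -
  have "m \<in> degree_ge e 1 \<longleftrightarrow> (\<Sum>v\<in>e. lookup m v) \<noteq> 0"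
    unfolding degree_ge_def mem_Collect_eq by linarith
  then show ?thesis by (auto simp: in_keys_iff)
qed

text \<open>
  The support of a monomial is a vertex cover iff the monomial is a multiple of the product of the
  variables in a minimal one.
\<close>

lemma edge_ideal_blocker:
  "edge_ideal (blocker H) = (mon_ideal (cover_upset H 1) :: ('v::finite, 'k::comm_ring_1) mpoly set)"
proof
  have cover: "m \<in> cover_upset H 1 \<longleftrightarrow> vertex_cover H (keys m)" for m
    unfolding cover_upset_def vertex_cover_def using degree_ge_one_iff by auto
  have keys: "keys (set_monom C) = C" for C :: "'v set"
    by (auto simp: in_keys_iff lookup_set_monom split: if_splits)
  show "edge_ideal (blocker H) \<subseteq> (mon_ideal (cover_upset H 1) :: ('v, 'k) mpoly set)"
    unfolding edge_ideal_def
    by (rule ideal.span_minimal[OF _ ring_ideal_mon_ideal[OF upset_cover_upset]])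
      (auto simp: prod_indet single_in_mon_ideal_iff cover keys blocker_def)
  show "mon_ideal (cover_upset H 1) \<subseteq> (edge_ideal (blocker H) :: ('v, 'k) mpoly set)"
  proof (rule mon_ideal_subset_ideal)
    fix m assume "m \<in> cover_upset H 1"
    then have "keys m \<in> {C. vertex_cover H C}" by (simp add: cover)
    then obtain D where D: "D \<subseteq> keys m" "vertex_cover H D"
      "\<And>D'. vertex_cover H D' \<Longrightarrow> D' \<subseteq> D \<Longrightarrow> D' = D"
      using finite_has_minimal2[of "{C. vertex_cover H C}" "keys m"] by auto
    have "D \<in> blocker H" using D by (auto simp: blocker_def)
    then have "single (set_monom D) 1 \<in> (edge_ideal (blocker H) :: ('v, 'k) mpoly set)"
      unfolding edge_ideal_def by (auto intro!: ideal.span_base simp flip: prod_indet)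
    moreover have "lookup (set_monom D) \<le> lookup m"
      using D(1) by (auto simp: le_fun_def lookup_set_monom in_keys_iff Suc_le_eq)
    then have "single m 1 = single (m - set_monom D) 1 * (single (set_monom D) 1 :: ('v, 'k) mpoly)"
      by (simp add: mult_single monom_diff_add)
    ultimately show "single m 1 \<in> (edge_ideal (blocker H) :: ('v, 'k) mpoly set)"
      unfolding edge_ideal_def by (auto intro: ideal.span_scale)
  qed (simp add: edge_ideal_def)
qed

text \<open>
  If \<open>p\<close> and \<open>q\<close> both have terms without variables from \<open>e\<close>, then the product of the largest
  such terms is a term of \<open>p q\<close>.
\<close>

lemma prime_ideal_variables:
  "prime_ideal (mon_ideal (degree_ge e 1) :: ('v::finite, 'k::field) mpoly set)"
  unfolding prime_ideal_def
proof (intro conjI allI impI)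
  show "ring_ideal (mon_ideal (degree_ge e 1) :: ('v, 'k) mpoly set)"
    by (rule ring_ideal_mon_ideal[OF upset_degree_ge])
  show "mon_ideal (degree_ge e 1) \<noteq> (UNIV :: ('v, 'k) mpoly set)"
    by (subst mon_ideal_ne_UNIV_iff[OF upset_degree_ge]) (simp add: degree_ge_def)
  fix p q :: "('v, 'k) mpoly"
  assume pq: "p * q \<in> mon_ideal (degree_ge e 1)"
  show "p \<in> mon_ideal (degree_ge e 1) \<or> q \<in> mon_ideal (degree_ge e 1)"
  proof (rule ccontr)
    assume "\<not> ?thesis"
    then have "keys p - degree_ge e 1 \<noteq> {}" "keys q - degree_ge e 1 \<noteq> {}"
      by (auto simp: mon_ideal_def)
    then obtain a b where a: "a \<in> keys p - degree_ge e 1"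
      "\<And>a'. a' \<in> keys p - degree_ge e 1 \<Longrightarrow> lex_code a' \<le> lex_code a"
      and b: "b \<in> keys q - degree_ge e 1"
      "\<And>b'. b' \<in> keys q - degree_ge e 1 \<Longrightarrow> lex_code b' \<le> lex_code b"
      using finite_monom_set_has_leading[of "keys p - degree_ge e 1"]
        finite_monom_set_has_leading[of "keys q - degree_ge e 1"] by (metis finite_Diff finite_keys)
    have zero: "a' + b' \<notin> degree_ge e 1 \<longleftrightarrow> a' \<notin> degree_ge e 1 \<and> b' \<notin> degree_ge e 1" for a' b'
      unfolding degree_ge_def mem_Collect_eq lookup_add sum.distrib by linarith
    have "lookup (p * q) (a + b) = lookup p a * lookup q b"
    proof (rule lookup_times_leading)
      fix a' b' assume *: "a' \<in> keys p" "b' \<in> keys q" "a' + b' = a + b"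
      have "a + b \<notin> degree_ge e 1" using a(1) b(1) zero by blast
      then have "a' \<notin> degree_ge e 1 \<and> b' \<notin> degree_ge e 1" using zero *(3) by metis
      then show "lex_code a' \<le> lex_code a \<and> lex_code b' \<le> lex_code b"
        using * a(2) b(2) by blast
    qed (use a b in auto)
    then have "a + b \<in> keys (p * q)" using a(1) b(1) by (simp add: in_keys_iff)
    then show False using pq a(1) b(1) zero[of a b] by (auto simp: mon_ideal_def)
  qed
qed

text \<open>
  An associated prime \<open>(J : f)\<close> is the intersection of the primes \<open>(e)\<close> that do not contain \<open>f\<close>, and
  so one of them; conversely \<open>(e) = (J : f)\<close> for the product \<open>f\<close> of the variables outside \<open>e\<close>.
\<close>

lemma associated_primes_cover_ideal:
  fixes H :: "('v::finite) set set"
  assumes clutter: "\<And>e e'. e \<in> H \<Longrightarrow> e' \<in> H \<Longrightarrow> e \<subseteq> e' \<Longrightarrow> e = e'"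
  shows "associated_primes (mon_ideal (cover_upset H 1) :: ('v, 'k::field) mpoly set)
      = (\<lambda>e. mon_ideal (degree_ge e 1)) ` H"
proof
  let ?p = "\<lambda>e. mon_ideal (degree_ge e 1) :: ('v, 'k) mpoly set"
  let ?J = "mon_ideal (cover_upset H 1) :: ('v, 'k) mpoly set"
  have J: "?J = (\<Inter>e\<in>H. ?p e)" by (rule mon_ideal_cover_upset)
  have ideal: "ring_ideal (?p e)" for e using prime_ideal_variables by (auto simp: prime_ideal_def)
  have times: "g * f \<in> ?p e \<longleftrightarrow> g \<in> ?p e \<or> f \<in> ?p e" for f g e
    using prime_ideal_variables[of e] ideal_mult_right[OF ideal] ideal.subspace_scale[OF ideal]
    unfolding prime_ideal_def by blast
  show "associated_primes ?J \<subseteq> ?p ` H"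
  proof
    fix P assume "P \<in> associated_primes ?J"
    then obtain f where P: "prime_ideal P" and Pf: "P = {g. g * f \<in> ?J}"
      by (auto simp: associated_primes_def)
    define A where "A = {e \<in> H. f \<notin> ?p e}"
    have PA: "P = (\<Inter>e\<in>A. ?p e)" unfolding Pf J by (auto simp: times A_def)
    have "\<exists>e\<in>A. ?p e \<subseteq> P"
    proof (rule ccontr)
      assume "\<not> ?thesis"
      then have "\<forall>e\<in>A. \<exists>x. x \<in> ?p e \<and> x \<notin> P" by blast
      then obtain g where g: "\<And>e. e \<in> A \<Longrightarrow> g e \<in> ?p e" "\<And>e. e \<in> A \<Longrightarrow> g e \<notin> P"
        using bchoice[of A "\<lambda>e x. x \<in> ?p e \<and> x \<notin> P"] by blast
      have "prod g B \<notin> P" if "B \<subseteq> A" for B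
        using finite[of B] that
      proof (induction B rule: finite_induct)
        case empty
        then show ?case using P by (auto simp: prime_ideal_def ideal_one_iff)
      next
        case (insert e B)
        then show ?case using P g(2)[of e] by (auto simp: prime_ideal_def)
      qed
      moreover have "prod g A \<in> ?p e" if "e \<in> A" for e
        using that ideal_mult_right[OF ideal g(1)[OF that]] by (simp add: prod.remove[of A e])
      ultimately show False using PA by blast
    qed
    then show "P \<in> ?p ` H" using PA by (auto simp: A_def)
  qed
  show "?p ` H \<subseteq> associated_primes ?J"
  proof (rule image_subsetI)
    fix e assume e: "e \<in> H"
    define f where "f = (single (set_monom (- e)) 1 :: ('v, 'k) mpoly)"
    have f: "f \<in> ?p e' \<longleftrightarrow> e' \<noteq> e" if "e' \<in> H" for e'
    proof -
      have "f \<in> ?p e' \<longleftrightarrow> \<not> e' \<subseteq> e"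
        by (auto simp: f_def single_in_mon_ideal_iff degree_ge_one_iff
            lookup_set_monom in_keys_iff split: if_splits)
      then show ?thesis using clutter[OF that e] by auto
    qed
    have "?p e = {g. g * f \<in> ?J}" unfolding J using f e by (auto simp: times)
    then show "?p e \<in> associated_primes ?J"
      unfolding associated_primes_def using prime_ideal_variables[of e] by blast
  qed
qed

lemma ideal_power_variables:
  "ideal_power (mon_ideal (degree_ge e 1)) k
     = (mon_ideal (degree_ge e k) :: ('v::finite, 'k::comm_ring_1) mpoly set)"
proof (induction k)
  case 0
  then show ?case by (auto simp: mon_ideal_def degree_ge_def)
next
  case (Suc k)
  let ?p = "\<lambda>k. mon_ideal (degree_ge e k) :: ('v, 'k) mpoly set"
  have "{a * b | a b. a \<in> ?p 1 \<and> b \<in> ?p k} \<subseteq> ?p (Suc k)"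
  proof clarify
    fix a b assume "a \<in> ?p 1" "b \<in> ?p k"
    then show "a * b \<in> ?p (Suc k)"
      using keys_mult[of a b] by (fastforce simp: mon_ideal_def degree_ge_def lookup_add sum.distrib)
  qed
  then have "ideal_gen {a * b | a b. a \<in> ?p 1 \<and> b \<in> ?p k} \<subseteq> ?p (Suc k)"
    by (rule ideal.span_minimal[OF _ ring_ideal_mon_ideal[OF upset_degree_ge]])
  moreover have "?p (Suc k) \<subseteq> ideal_gen {a * b | a b. a \<in> ?p 1 \<and> b \<in> ?p k}"
  proof (rule mon_ideal_subset_ideal)
    fix m assume m: "m \<in> degree_ge e (Suc k)"
    then have "m \<in> degree_ge e 1" by (simp add: degree_ge_def)
    then have "keys m \<inter> e \<noteq> {}" using degree_ge_one_iff by blast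
    then obtain v where v: "v \<in> e" "lookup m v \<noteq> 0" by (auto simp: in_keys_iff)
    have one: "(\<Sum>w\<in>e. lookup (single v 1) w) = (1::nat)"
      using v(1) by (simp add: lookup_single when_def)
    have le: "lookup (single v 1) \<le> lookup m" using v(2) by (auto simp: le_fun_def lookup_single when_def)
    have "(\<Sum>w\<in>e. lookup m w) = (\<Sum>w\<in>e. lookup (m - single v 1 + single v 1) w)"
      by (simp only: monom_diff_add[OF le])
    also have "\<dots> = (\<Sum>w\<in>e. lookup (m - single v 1) w) + 1"
      by (simp only: lookup_add sum.distrib one)
    finally have "(\<Sum>w\<in>e. lookup m w) = (\<Sum>w\<in>e. lookup (m - single v 1) w) + 1" .
    then have "m - single v 1 \<in> degree_ge e k" using m by (simp add: degree_ge_def)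
    moreover have "single v 1 \<in> degree_ge e 1" using one by (simp add: degree_ge_def)
    moreover have "single m 1 = single (single v 1) 1 * (single (m - single v 1) 1 :: ('v, 'k) mpoly)"
      using monom_diff_add[OF le] by (simp only: mult_single add.commute[of "single v 1"] mult_1)
    ultimately show "single m 1 \<in> ideal_gen {a * b | a b. a \<in> ?p 1 \<and> b \<in> ?p k}"
      by (intro ideal.span_base CollectI) (metis single_in_mon_ideal_iff)
  qed simp
  ultimately show ?case using Suc.IH by simp
qed

lemma symbolic_power_cover_ideal:
  fixes H :: "('v::finite) set set"
  assumes "\<And>e e'. e \<in> H \<Longrightarrow> e' \<in> H \<Longrightarrow> e \<subseteq> e' \<Longrightarrow> e = e'"
  shows "symbolic_power (edge_ideal (blocker H)) k
      = (mon_ideal (cover_upset H k) :: ('v, 'k::field) mpoly set)"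
  unfolding symbolic_power_def edge_ideal_blocker
  by (subst associated_primes_cover_ideal[OF assms])
    (simp_all add: ideal_power_variables mon_ideal_cover_upset)

text \<open>
  Multiplication by the product of the variables in \<open>C\<close> raises the degree with respect to each
  edge by exactly one.
\<close>

lemma cover_upset_eq_colon:
  assumes "\<And>e. e \<in> H \<Longrightarrow> card (C \<inter> e) = 1"
  shows "cover_upset H k = colon (cover_upset H (Suc k)) (set_monom C)"
proof -
  have "(\<Sum>v\<in>e. lookup (set_monom C) v) = 1" if "e \<in> H" for e
    using assms[OF that] by (simp add: lookup_set_monom sum.If_cases Int_commute)
  then show ?thesis
    by (auto simp: cover_upset_def colon_def degree_ge_def lookup_add sum.distrib)
qed


declare One_nat_def [simp]


section \<open>Comparison of graded free resolutions\<close>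

lemma mdeg_eq_sum: "mdeg m = (\<Sum>v\<in>UNIV. lookup m (v :: 'v::finite))"
  unfolding mdeg_def by (rule sum.mono_neutral_left) (auto simp: in_keys_iff)

lemma mdeg_add: "mdeg (a + b) = mdeg a + mdeg (b :: ('v::finite) monom)"
  by (simp add: mdeg_eq_sum lookup_add sum.distrib)

definition hom_component :: "int \<Rightarrow> ('v, 'k::comm_ring_1) mpoly \<Rightarrow> ('v, 'k) mpoly" where
  "hom_component n p = Abs_poly_mapping (\<lambda>m. if int (mdeg m) = n then lookup p m else 0)"

lemma lookup_hom_component:
  "lookup (hom_component n p) m = (if int (mdeg m) = n then lookup p m else 0)"
proof -
  have "finite {m. (if int (mdeg m) = n then lookup p m else 0) \<noteq> 0}"
    by (rule finite_subset[of _ "keys p"]) (auto simp: in_keys_iff split: if_splits)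
  then show ?thesis by (simp add: hom_component_def)
qed

lemma hom_component_sum: "hom_component n (sum f A) = (\<Sum>i\<in>A. hom_component n (f i))"
  by (rule poly_mapping_eqI) (simp add: lookup_hom_component lookup_sum)

lemma hom_component_times:
  fixes a p :: "('v::finite, 'k::comm_ring_1) mpoly"
  assumes "\<And>m. m \<in> keys a \<Longrightarrow> int (mdeg m) = d"
  shows "hom_component (d + n) (a * p) = a * hom_component n p"
proof (rule poly_mapping_eqI)
  fix m
  have split: "a * p = a * hom_component n p + a * (p - hom_component n p)"
    by (simp add: algebra_simps)
  have deg: "int (mdeg k) = d + n" if "k \<in> keys (a * hom_component n p)" for k
    using that keys_mult[of a "hom_component n p"] assms
    by (auto simp: in_keys_iff lookup_hom_component mdeg_add split: if_splits)
  have ndeg: "int (mdeg k) \<noteq> d + n" if "k \<in> keys (a * (p - hom_component n p))" for k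
    using that keys_mult[of a "p - hom_component n p"] assms
    by (auto simp: in_keys_iff lookup_hom_component lookup_minus mdeg_add split: if_splits)
  show "lookup (hom_component (d + n) (a * p)) m = lookup (a * hom_component n p) m"
  proof (cases "int (mdeg m) = d + n")
    case True
    then have "lookup (a * (p - hom_component n p)) m = 0" using ndeg by (auto simp: in_keys_iff)
    then show ?thesis using True by (simp add: lookup_hom_component split lookup_add)
  next
    case False
    then have "lookup (a * hom_component n p) m = 0" using deg by (auto simp: in_keys_iff)
    then show ?thesis using False by (simp add: lookup_hom_component)
  qed
qed

text \<open>The matrices of degree 0 maps from the free module with shifts \<open>T\<close> to the one with shifts \<open>D\<close>.\<close>

definition hom_mat :: "int list \<Rightarrow> int list \<Rightarrow> ('v, 'k::comm_ring_1) mpoly mat \<Rightarrow> bool" where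
  "hom_mat D T X \<longleftrightarrow> X \<in> carrier_mat (length D) (length T) \<and>
     (\<forall>p<length D. \<forall>q<length T. \<forall>m\<in>keys (X $$ (p, q)). int (mdeg m) = T ! q - D ! p)"

lemma hom_mat_carrier: "hom_mat D T X \<Longrightarrow> X \<in> carrier_mat (length D) (length T)"
  by (simp add: hom_mat_def)

lemma index_mult_mat_sum:
  assumes "A \<in> carrier_mat n k" "B \<in> carrier_mat k m" "i < n" "j < m"
  shows "(A * B) $$ (i, j) = (\<Sum>r<k. A $$ (i, r) * B $$ (r, j))"
  using assms by (auto simp: scalar_prod_def atLeast0LessThan intro!: sum.cong)

lemma hom_mat_mult:
  fixes X Y :: "('v::finite, 'k::comm_ring_1) mpoly mat"
  assumes X: "hom_mat D T X" and Y: "hom_mat T S Y"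
  shows "hom_mat D S (X * Y)"
  unfolding hom_mat_def
proof (intro conjI allI impI ballI)
  fix p q m assume p: "p < length D" and q: "q < length S" and m: "m \<in> keys ((X * Y) $$ (p, q))"
  then have "m \<in> keys (\<Sum>r<length T. X $$ (p, r) * Y $$ (r, q))"
    by (simp only: index_mult_mat_sum[OF hom_mat_carrier[OF X] hom_mat_carrier[OF Y]])
  then obtain r where r: "r < length T" "m \<in> keys (X $$ (p, r) * Y $$ (r, q))"
    using keys_sum[of "\<lambda>r. X $$ (p, r) * Y $$ (r, q)" "{..<length T}"] by auto
  then obtain a b where "m = a + b" "a \<in> keys (X $$ (p, r))" "b \<in> keys (Y $$ (r, q))"
    using keys_mult by blast
  then show "int (mdeg m) = S ! q - D ! p"
    using X Y p q r(1) by (simp add: hom_mat_def mdeg_add)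
qed (use X Y in \<open>auto simp: hom_mat_def\<close>)

lemma lift_mat:
  assumes \<Phi>: "\<Phi> \<in> carrier_mat n k" and Y: "Y \<in> carrier_mat n m"
    and im: "\<And>q. q < m \<Longrightarrow> col Y q \<in> mat_image \<Phi>"
  shows "\<exists>X\<in>carrier_mat k m. \<Phi> * X = Y"
proof -
  have "\<exists>w. w \<in> carrier_vec k \<and> \<Phi> *\<^sub>v w = col Y q" if "q < m" for q
    using im[OF that] \<Phi> by (auto simp: mat_image_def)
  then obtain w where w: "\<And>q. q < m \<Longrightarrow> w q \<in> carrier_vec k"
    "\<And>q. q < m \<Longrightarrow> \<Phi> *\<^sub>v w q = col Y q" by metis
  define X where "X = mat k m (\<lambda>(i, q). w q $ i)"
  have "\<Phi> * X = Y"
  proof (rule eq_matI)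
    fix p q assume "p < dim_row Y" "q < dim_col Y"
    then have pq: "p < n" "q < m" using Y by auto
    have "col X q = w q" using pq w(1)[OF pq(2)] by (auto simp: X_def)
    then have "(\<Phi> * X) $$ (p, q) = (\<Phi> *\<^sub>v w q) $ p" using pq \<Phi> by (simp add: X_def)
    also have "\<dots> = Y $$ (p, q)" using w(2)[OF pq(2)] pq Y by simp
    finally show "(\<Phi> * X) $$ (p, q) = Y $$ (p, q)" .
  qed (use \<Phi> Y in \<open>auto simp: X_def\<close>)
  then show ?thesis by (intro bexI[of _ X]) (auto simp: X_def)
qed

text \<open>A lift of a homogeneous map along a homogeneous map can be replaced by its part of degree 0.\<close>

lemma lift_hom_mat:
  fixes \<Phi> Y :: "('v::finite, 'k::comm_ring_1) mpoly mat"
  assumes \<Phi>: "hom_mat D T \<Phi>" and Y: "hom_mat D S Y"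
    and im: "\<And>q. q < length S \<Longrightarrow> col Y q \<in> mat_image \<Phi>"
  shows "\<exists>X. hom_mat T S X \<and> \<Phi> * X = Y"
proof -
  obtain W where W: "W \<in> carrier_mat (length T) (length S)" "\<Phi> * W = Y"
    using lift_mat[OF hom_mat_carrier[OF \<Phi>] hom_mat_carrier[OF Y] im] by blast
  define X where "X = mat (length T) (length S) (\<lambda>(i, q). hom_component (S ! q - T ! i) (W $$ (i, q)))"
  have X: "hom_mat T S X"
    by (auto simp: hom_mat_def X_def in_keys_iff lookup_hom_component split: if_splits)
  have "\<Phi> * X = Y"
  proof (rule eq_matI)
    fix p q assume "p < dim_row Y" "q < dim_col Y"
    then have pq: "p < length D" "q < length S" using hom_mat_carrier[OF Y] by auto
    have "(\<Phi> * X) $$ (p, q) = (\<Sum>r<length T. \<Phi> $$ (p, r) * hom_component (S ! q - T ! r) (W $$ (r, q)))"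
      unfolding index_mult_mat_sum[OF hom_mat_carrier[OF \<Phi>] hom_mat_carrier[OF X] pq]
      using pq by (intro sum.cong) (auto simp: X_def)
    also have "\<dots> = (\<Sum>r<length T. hom_component (S ! q - D ! p) (\<Phi> $$ (p, r) * W $$ (r, q)))"
    proof (rule sum.cong)
      fix r assume "r \<in> {..<length T}"
      then have "int (mdeg m) = T ! r - D ! p" if "m \<in> keys (\<Phi> $$ (p, r))" for m
        using \<Phi> pq that by (auto simp: hom_mat_def)
      from hom_component_times[OF this, where n = "S ! q - T ! r" and p = "W $$ (r, q)"]
      show "\<Phi> $$ (p, r) * hom_component (S ! q - T ! r) (W $$ (r, q))
          = hom_component (S ! q - D ! p) (\<Phi> $$ (p, r) * W $$ (r, q))" by simp
    qed simp
    also have "\<dots> = hom_component (S ! q - D ! p) (Y $$ (p, q))"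
      unfolding W(2)[symmetric] index_mult_mat_sum[OF hom_mat_carrier[OF \<Phi>] W(1) pq]
      by (simp add: hom_component_sum)
    also have "\<dots> = Y $$ (p, q)"
      using Y pq by (intro poly_mapping_eqI) (auto simp: lookup_hom_component hom_mat_def not_in_keys_iff_lookup_eq_zero[symmetric])
    finally show "(\<Phi> * X) $$ (p, q) = Y $$ (p, q)" .
  qed (use hom_mat_carrier[OF \<Phi>] hom_mat_carrier[OF X] hom_mat_carrier[OF Y] in auto)
  then show ?thesis using X by blast
qed

lemma graded_free_resolution_hom_mat:
  "graded_free_resolution I d \<phi> \<Longrightarrow> hom_mat (d i) (d (Suc i)) (\<phi> i)"
  by (simp add: graded_free_resolution_def hom_mat_def)

lemma col_in_mat_image:
  assumes "A \<in> carrier_mat n m" "q < m"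
  shows "col A q \<in> mat_image A"
proof -
  have "A *\<^sub>v unit_vec m q = col A q"
    using col_mult2[OF assms(1) one_carrier_mat assms(2)] assms by simp
  then show ?thesis using assms by (auto simp: mat_image_def intro!: image_eqI[of _ _ "unit_vec m q"])
qed

lemma graded_free_resolution_complex:
  assumes "graded_free_resolution I d \<phi>"
  shows "\<phi> i * \<phi> (Suc i) = 0\<^sub>m (length (d i)) (length (d (Suc (Suc i))))"
proof (rule eq_matI)
  have c: "\<phi> i \<in> carrier_mat (length (d i)) (length (d (Suc i)))" for i
    using assms by (simp add: graded_free_resolution_def)
  fix p q assume "p < dim_row (0\<^sub>m (length (d i)) (length (d (Suc (Suc i)))))"
    "q < dim_col (0\<^sub>m (length (d i)) (length (d (Suc (Suc i)))))"
  then have pq: "p < length (d i)" "q < length (d (Suc (Suc i)))" by auto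
  have "col (\<phi> (Suc i)) q \<in> mat_kernel (\<phi> i)"
    using assms col_in_mat_image[OF c pq(2)] by (simp add: graded_free_resolution_def)
  then have "\<phi> i *\<^sub>v col (\<phi> (Suc i)) q = 0\<^sub>v (length (d i))" using c[of i] by (simp add: mat_kernel_def)
  then have "(\<phi> i *\<^sub>v col (\<phi> (Suc i)) q) $ p = 0" using pq by simp
  then show "(\<phi> i * \<phi> (Suc i)) $$ (p, q) = 0\<^sub>m (length (d i)) (length (d (Suc (Suc i)))) $$ (p, q)"
    using pq c[of i] c[of "Suc i"] by simp
qed (use assms in \<open>auto simp: graded_free_resolution_def\<close>)

lemma col_in_kernel_imp_image:
  assumes res: "graded_free_resolution I d \<phi>"
    and Z: "Z \<in> carrier_mat (length (d (Suc i))) m" and zero: "\<phi> i * Z = 0\<^sub>m (length (d i)) m" and q: "q < m"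
  shows "col Z q \<in> mat_image (\<phi> (Suc i))"
proof -
  have c: "\<phi> i \<in> carrier_mat (length (d i)) (length (d (Suc i)))"
    using res by (simp add: graded_free_resolution_def)
  have "\<phi> i *\<^sub>v col Z q = col (\<phi> i * Z) q" by (rule col_mult2[OF c Z q, symmetric])
  then have "col Z q \<in> mat_kernel (\<phi> i)"
    using c Z q by (intro mat_kernelI[OF c]) (auto simp: zero)
  then show ?thesis using res by (simp add: graded_free_resolution_def)
qed

lemma graded_chain_map_exists:
  fixes \<phi> \<psi> :: "nat \<Rightarrow> ('v::finite, 'k::comm_ring_1) mpoly mat"
  assumes \<phi>: "graded_free_resolution I d \<phi>" and \<psi>: "graded_free_resolution I d' \<psi>"
  shows "\<exists>\<alpha>. \<alpha> 0 = 1\<^sub>m 1 \<and> (\<forall>i. hom_mat (d' i) (d i) (\<alpha> i)) \<and> (\<forall>i. \<psi> i * \<alpha> (Suc i) = \<alpha> i * \<phi> i)"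
proof -
  have d0: "d 0 = [0]" "d' 0 = [0]" using \<phi> \<psi> by (auto simp: graded_free_resolution_def)
  have h\<phi>: "hom_mat (d i) (d (Suc i)) (\<phi> i)" and h\<psi>: "hom_mat (d' i) (d' (Suc i)) (\<psi> i)" for i
    using \<phi> \<psi> by (auto intro: graded_free_resolution_hom_mat)
  note c\<phi> = hom_mat_carrier[OF h\<phi>] and c\<psi> = hom_mat_carrier[OF h\<psi>]
  let ?P = "\<lambda>i A. hom_mat (d' i) (d i) A \<and> (i = 0 \<longrightarrow> A = 1\<^sub>m 1) \<and>
    (\<forall>q<length (d (Suc i)). col (A * \<phi> i) q \<in> mat_image (\<psi> i))"
  have "\<exists>\<alpha>. \<forall>i. ?P i (\<alpha> i) \<and> \<psi> i * \<alpha> (Suc i) = \<alpha> i * \<phi> i"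
  proof (rule dependent_nat_choice)
    have im: "mat_image (\<phi> 0) = mat_image (\<psi> 0)"
      using \<phi> \<psi> by (simp add: graded_free_resolution_def)
    have "hom_mat (d' 0) (d 0) (1\<^sub>m 1)" by (auto simp: hom_mat_def d0 mdeg_def)
    moreover have "1\<^sub>m 1 * \<phi> 0 = \<phi> 0" using c\<phi>[of 0] by (simp add: d0)
    ultimately have "?P 0 (1\<^sub>m 1)" using col_in_mat_image[OF c\<phi>[of 0]] im by simp
    then show "\<exists>A. ?P 0 A" by blast
  next
    fix A i assume A: "?P i A"
    then have hA: "hom_mat (d' i) (d i) A" by simp
    note cA = hom_mat_carrier[OF hA]
    obtain B where B: "hom_mat (d' (Suc i)) (d (Suc i)) B" "\<psi> i * B = A * \<phi> i"
      using lift_hom_mat[OF h\<psi> hom_mat_mult[OF hA h\<phi>]] A by blast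
    note cB = hom_mat_carrier[OF B(1)]
    have "\<psi> i * (B * \<phi> (Suc i)) = (\<psi> i * B) * \<phi> (Suc i)"
      by (rule assoc_mult_mat[OF c\<psi> cB c\<phi>, symmetric])
    also have "\<dots> = A * (\<phi> i * \<phi> (Suc i))"
      unfolding B(2) by (rule assoc_mult_mat[OF cA c\<phi> c\<phi>])
    also have "\<dots> = 0\<^sub>m (length (d' i)) (length (d (Suc (Suc i))))"
      using cA by (simp add: graded_free_resolution_complex[OF \<phi>])
    finally have zero: "\<psi> i * (B * \<phi> (Suc i)) = 0\<^sub>m (length (d' i)) (length (d (Suc (Suc i))))" .
    have "?P (Suc i) B"
      using B(1) col_in_kernel_imp_image[OF \<psi> mult_carrier_mat[OF cB c\<phi>] zero] by simp
    then show "\<exists>B. ?P (Suc i) B \<and> \<psi> i * B = A * \<phi> i" using B(2) by blast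
  qed
  then show ?thesis by (metis (no_types, lifting))
qed

text \<open>
  An endomorphism \<open>\<theta>\<close> of a minimal resolution that lifts the identity is the identity modulo \<open>\<mm>\<close>:
  by induction \<open>\<theta> - 1 = \<phi> X + Y\<close> with the homotopy \<open>X\<close>, where \<open>Y\<close>, the composition of the previous
  homotopy with \<open>\<phi>\<close>, has entries in \<open>\<mm>\<close> and is killed by the next \<open>\<phi>\<close>.
\<close>

lemma minimal_resolution_endomorphism:
  fixes \<phi> :: "nat \<Rightarrow> ('v::finite, 'k::comm_ring_1) mpoly mat"
  assumes min: "minimal_graded_free_resolution I d \<phi>"
    and \<theta>: "\<And>i. \<theta> i \<in> carrier_mat (length (d i)) (length (d i))" and \<theta>0: "\<theta> 0 = 1\<^sub>m 1"
    and comm: "\<And>i. \<phi> i * \<theta> (Suc i) = \<theta> i * \<phi> i"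
  shows "\<exists>X\<in>carrier_mat (length (d (Suc i))) (length (d i)). \<exists>Y\<in>carrier_mat (length (d i)) (length (d i)).
    \<theta> i - 1\<^sub>m (length (d i)) = \<phi> i * X + Y \<and> Y * \<phi> i = 0\<^sub>m (length (d i)) (length (d (Suc i))) \<and>
    (\<forall>p<length (d i). \<forall>q<length (d i). lookup (Y $$ (p, q)) 0 = 0)"
proof (induction i)
  have res: "graded_free_resolution I d \<phi>" using min by (simp add: minimal_graded_free_resolution_def)
  then have d0: "d 0 = [0]" by (simp add: graded_free_resolution_def)
  have c: "\<phi> i \<in> carrier_mat (length (d i)) (length (d (Suc i)))" for i
    using res by (simp add: graded_free_resolution_def)
  {
    case 0
    have "\<theta> 0 - 1\<^sub>m 1 = \<phi> 0 * 0\<^sub>m (length (d (Suc 0))) 1 + 0\<^sub>m 1 1"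
      using c[of 0] by (simp add: \<theta>0 d0)
    then show ?case
      using c[of 0] by (intro bexI[of _ "0\<^sub>m (length (d (Suc 0))) 1"] bexI[of _ "0\<^sub>m 1 1"]) (auto simp: d0)
  next
    case (Suc i)
    let ?n = "length (d i)" and ?n1 = "length (d (Suc i))" and ?n2 = "length (d (Suc (Suc i)))"
    obtain X Y where X: "X \<in> carrier_mat ?n1 ?n" and Y: "Y \<in> carrier_mat ?n ?n"
      and XY: "\<theta> i - 1\<^sub>m ?n = \<phi> i * X + Y" and Y0: "Y * \<phi> i = 0\<^sub>m ?n ?n1"
      using Suc.IH by blast
    define Z where "Z = \<theta> (Suc i) - 1\<^sub>m ?n1 - X * \<phi> i"
    have Xc: "X * \<phi> i \<in> carrier_mat ?n1 ?n1" using X c[of i] by simp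
    have Z: "Z \<in> carrier_mat ?n1 ?n1" unfolding Z_def by (rule minus_carrier_mat[OF Xc])
    have "\<phi> i * Z = \<phi> i * \<theta> (Suc i) - \<phi> i * 1\<^sub>m ?n1 - \<phi> i * (X * \<phi> i)"
      unfolding Z_def using c[of i] \<theta>[of "Suc i"] Xc
      by (subst mult_minus_distrib_mat[of _ ?n ?n1 _ ?n1], auto)
        (subst mult_minus_distrib_mat[of _ ?n ?n1 _ ?n1], auto)
    also have "\<dots> = (\<theta> i - 1\<^sub>m ?n) * \<phi> i - (\<phi> i * X) * \<phi> i"
      using c[of i] \<theta>[of i] X
      by (subst minus_mult_distrib_mat[of _ ?n ?n _ _ ?n1]) (auto simp: comm)
    also have "\<dots> = (\<phi> i * X) * \<phi> i + Y * \<phi> i - (\<phi> i * X) * \<phi> i"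
      unfolding XY using c[of i] X Y by (subst add_mult_distrib_mat[of _ ?n ?n _ _ ?n1]) auto
    also have "\<dots> = 0\<^sub>m ?n ?n1"
      using c[of i] X by (intro eq_matI) (auto simp: Y0)
    finally have zero: "\<phi> i * Z = 0\<^sub>m ?n ?n1" .
    obtain X' where X': "X' \<in> carrier_mat ?n2 ?n1" "\<phi> (Suc i) * X' = Z"
      using lift_mat[OF c Z col_in_kernel_imp_image[OF res Z zero]] by blast
    have "\<theta> (Suc i) - 1\<^sub>m ?n1 = \<phi> (Suc i) * X' + X * \<phi> i"
      unfolding X'(2) Z_def using \<theta>[of "Suc i"] Xc by (intro eq_matI) auto
    moreover have "X * \<phi> i * \<phi> (Suc i) = 0\<^sub>m ?n1 ?n2"
    proof -
      have "X * \<phi> i * \<phi> (Suc i) = X * (\<phi> i * \<phi> (Suc i))" by (rule assoc_mult_mat[OF X c c])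
      then show ?thesis using X by (simp add: graded_free_resolution_complex[OF res])
    qed
    moreover have "lookup ((X * \<phi> i) $$ (p, q)) 0 = 0" if "p < ?n1" "q < ?n1" for p q
    proof -
      have "lookup (\<phi> i $$ (r, q)) 0 = 0" if "r < ?n" for r
      proof -
        have "\<phi> i $$ (r, q) \<in> elements_mat (\<phi> i)"
          by (rule elements_matI[OF c that \<open>q < ?n1\<close> refl])
        then show ?thesis
          using min in_graded_maximal_ideal_iff unfolding minimal_graded_free_resolution_def by blast
      qed
      then show ?thesis
        unfolding index_mult_mat_sum[OF X c that] by (simp add: lookup_sum lookup_times_0)
    qed
    ultimately show ?case using X'(1) Xc by blast
  }
qed

text \<open>
  Composing chain maps between the two resolutions gives \<open>\<beta> \<alpha> \<equiv> 1\<close> modulo \<open>\<mm>\<close>. Hence each diagonal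
  entry of \<open>\<beta> \<alpha>\<close> has a nonzero constant term, which comes from a degree 0 entry of \<open>\<alpha>\<close>.
\<close>

theorem minimal_resolution_shifts_subset:
  fixes \<phi> \<psi> :: "nat \<Rightarrow> ('v::finite, 'k::comm_ring_1) mpoly mat"
  assumes min: "minimal_graded_free_resolution I d \<phi>" and \<psi>: "graded_free_resolution I d' \<psi>"
  shows "set (d i) \<subseteq> set (d' i)"
proof
  have \<phi>: "graded_free_resolution I d \<phi>" using min by (simp add: minimal_graded_free_resolution_def)
  have c\<phi>: "\<phi> i \<in> carrier_mat (length (d i)) (length (d (Suc i)))" for i
    using \<phi> by (simp add: graded_free_resolution_def)
  have c\<psi>: "\<psi> i \<in> carrier_mat (length (d' i)) (length (d' (Suc i)))" for i
    using \<psi> by (simp add: graded_free_resolution_def)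
  obtain \<alpha> where \<alpha>0: "\<alpha> 0 = 1\<^sub>m 1" and \<alpha>: "\<And>i. hom_mat (d' i) (d i) (\<alpha> i)"
    and \<alpha>c: "\<And>i. \<psi> i * \<alpha> (Suc i) = \<alpha> i * \<phi> i"
    using graded_chain_map_exists[OF \<phi> \<psi>] by blast
  obtain \<beta> where \<beta>0: "\<beta> 0 = 1\<^sub>m 1" and \<beta>: "\<And>i. hom_mat (d i) (d' i) (\<beta> i)"
    and \<beta>c: "\<And>i. \<phi> i * \<beta> (Suc i) = \<beta> i * \<psi> i"
    using graded_chain_map_exists[OF \<psi> \<phi>] by blast
  note c\<alpha> = hom_mat_carrier[OF \<alpha>] and c\<beta> = hom_mat_carrier[OF \<beta>]
  have \<theta>: "\<beta> i * \<alpha> i \<in> carrier_mat (length (d i)) (length (d i))" for i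
    using c\<alpha> c\<beta> by (rule mult_carrier_mat[rotated])
  have \<theta>0: "\<beta> 0 * \<alpha> 0 = 1\<^sub>m 1" by (simp add: \<alpha>0 \<beta>0)
  have comm: "\<phi> i * (\<beta> (Suc i) * \<alpha> (Suc i)) = \<beta> i * \<alpha> i * \<phi> i" for i
  proof -
    have "\<phi> i * (\<beta> (Suc i) * \<alpha> (Suc i)) = \<phi> i * \<beta> (Suc i) * \<alpha> (Suc i)"
      by (rule assoc_mult_mat[OF c\<phi> c\<beta> c\<alpha>, symmetric])
    also have "\<dots> = \<beta> i * (\<psi> i * \<alpha> (Suc i))"
      unfolding \<beta>c by (rule assoc_mult_mat[OF c\<beta> c\<psi> c\<alpha>])
    also have "\<dots> = \<beta> i * \<alpha> i * \<phi> i"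
      unfolding \<alpha>c by (rule assoc_mult_mat[OF c\<beta> c\<alpha> c\<phi>, symmetric])
    finally show ?thesis .
  qed
  let ?n = "length (d i)"
  obtain X Y where X: "X \<in> carrier_mat (length (d (Suc i))) ?n" and Y: "Y \<in> carrier_mat ?n ?n"
    and XY: "\<beta> i * \<alpha> i - 1\<^sub>m ?n = \<phi> i * X + Y"
    and Y0: "\<And>p q. p < ?n \<Longrightarrow> q < ?n \<Longrightarrow> lookup (Y $$ (p, q)) 0 = 0"
    using minimal_resolution_endomorphism[OF min \<theta> \<theta>0 comm, of i] by blast
  fix j assume "j \<in> set (d i)"
  then obtain p where p: "p < ?n" "d i ! p = j" by (auto simp: in_set_conv_nth)
  have "lookup (\<phi> i $$ (p, r)) 0 = 0" if "r < length (d (Suc i))" for r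
  proof -
    have "\<phi> i $$ (p, r) \<in> elements_mat (\<phi> i)"
      by (rule elements_matI[OF c\<phi> p(1) that refl])
    then show ?thesis
      using min in_graded_maximal_ideal_iff unfolding minimal_graded_free_resolution_def by blast
  qed
  then have "lookup ((\<phi> i * X) $$ (p, p)) 0 = 0"
    unfolding index_mult_mat_sum[OF c\<phi> X p(1) p(1)] by (simp add: lookup_sum lookup_times_0)
  then have "lookup ((\<phi> i * X + Y) $$ (p, p)) 0 = 0"
    using p c\<phi>[of i] X Y Y0 by (simp add: lookup_add)
  then have "lookup ((\<beta> i * \<alpha> i - 1\<^sub>m ?n) $$ (p, p)) 0 = 0" by (simp only: XY)
  moreover have "(\<beta> i * \<alpha> i - 1\<^sub>m ?n) $$ (p, p) = (\<beta> i * \<alpha> i) $$ (p, p) - 1"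
    using p \<theta>[of i] by simp
  ultimately have "lookup ((\<beta> i * \<alpha> i) $$ (p, p)) 0 = 1" by (simp add: lookup_minus)
  then have "(\<Sum>r<length (d' i). lookup (\<beta> i $$ (p, r)) 0 * lookup (\<alpha> i $$ (r, p)) 0) \<noteq> 0"
    unfolding index_mult_mat_sum[OF c\<beta> c\<alpha> p(1) p(1)] by (simp add: lookup_sum lookup_times_0)
  then obtain r where r: "r < length (d' i)" "lookup (\<alpha> i $$ (r, p)) 0 \<noteq> 0"
    by (metis (no_types, lifting) lessThan_iff mult_zero_right sum.neutral)
  then have "0 \<in> keys (\<alpha> i $$ (r, p))" by (simp add: in_keys_iff)
  then have "int (mdeg (0 :: 'v monom)) = d i ! p - d' i ! r"
    using \<alpha>[of i] r p by (simp add: hom_mat_def)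
  then show "j \<in> set (d' i)" using r p by (simp add: mdeg_def)
qed


section \<open>Multigraded resolutions\<close>

text \<open>
  A map \<open>\<Oplus>\<^sub>r R(-g\<^sub>r) \<rightarrow> \<Oplus>\<^sub>q R(-b\<^sub>q)\<close> that respects the grading by monomials sends the \<open>r\<close>-th basis vector to
  \<open>(\<lambda>\<^sub>r\<^sub>q x\<^bsup>g\<^sub>r - b\<^sub>q\<^esup>)\<^sub>q\<close> with scalars \<open>\<lambda>\<^sub>r\<^sub>q\<close>. It is given by the list of the pairs \<open>(g\<^sub>r, \<lambda>\<^sub>r)\<close>. In each degree
  it is a linear map between vector spaces, which depends on the degrees only through the question
  which basis vectors live there.
\<close>

type_synonym ('v, 'k) mgens = "('v monom \<times> (nat \<Rightarrow> 'k)) list"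

text \<open>The part of degree \<open>g\<close> of \<open>\<Oplus>\<^sub>q R(-b\<^sub>q)\<close>, in coordinates.\<close>

definition graded_vecs :: "'v monom list \<Rightarrow> 'v monom \<Rightarrow> (nat \<Rightarrow> 'k::field) set" where
  "graded_vecs b g = {\<mu>. \<forall>r. \<mu> r \<noteq> 0 \<longrightarrow> r < length b \<and> lookup (b ! r) \<le> lookup g}"

definition lin :: "('v, 'k::field) mgens \<Rightarrow> (nat \<Rightarrow> 'k) \<Rightarrow> nat \<Rightarrow> 'k" where
  "lin L \<mu> = (\<lambda>q. \<Sum>r<length L. \<mu> r * snd (L ! r) q)"

definition mimage :: "('v, 'k::field) mgens \<Rightarrow> 'v monom \<Rightarrow> (nat \<Rightarrow> 'k) set" where
  "mimage L g = lin L ` graded_vecs (map fst L) g"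

definition mkernel :: "('v, 'k::field) mgens \<Rightarrow> 'v monom \<Rightarrow> (nat \<Rightarrow> 'k) set" where
  "mkernel L g = {\<mu> \<in> graded_vecs (map fst L) g. lin L \<mu> = (\<lambda>_. 0)}"

text \<open>
  A relation in the degree of the \<open>p\<close>-th generator with nonzero \<open>p\<close>-th coordinate would express this
  generator by the other ones.
\<close>

definition irredundant :: "('v, 'k::field) mgens \<Rightarrow> bool" where
  "irredundant L \<longleftrightarrow> (\<forall>p<length L. \<forall>\<mu>\<in>mkernel L (fst (L ! p)). \<mu> p = 0)"

text \<open>
  \<open>W\<close> lists the homogeneous parts of a submodule of \<open>\<Oplus>\<^sub>q R(-b\<^sub>q)\<close>. In coordinates multiplication by a
  monomial is an inclusion, so that the submodule property is monotonicity in the degree; the last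
  clause says that the submodule is generated in exponents at most \<open>N\<close>.
\<close>

definition mg_submodule :: "'v monom list \<Rightarrow> (('v::finite) monom \<Rightarrow> (nat \<Rightarrow> 'k::field) set) \<Rightarrow> bool" where
  "mg_submodule b W \<longleftrightarrow>
     (\<forall>g. W g \<subseteq> graded_vecs b g) \<and> (\<forall>g. (\<lambda>_. 0) \<in> W g) \<and>
     (\<forall>g. \<forall>x\<in>W g. \<forall>y\<in>W g. (\<lambda>q. x q + y q) \<in> W g) \<and>
     (\<forall>g. \<forall>x\<in>W g. \<forall>c. (\<lambda>q. c * x q) \<in> W g) \<and>
     (\<forall>g h. lookup g \<le> lookup h \<longrightarrow> W g \<subseteq> W h) \<and>
     (\<exists>N. \<forall>g. W g \<subseteq> W (cap N g))"

text \<open>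
  If some vector of \<open>V\<close> has a nonzero last coordinate, then it spans \<open>V\<close> together with the vectors whose
  last coordinate vanishes.
\<close>

lemma finite_spanning_set:
  fixes V :: "(nat \<Rightarrow> 'k::field) set"
  assumes "\<And>x q. x \<in> V \<Longrightarrow> n \<le> q \<Longrightarrow> x q = 0"
    and "\<And>x y. x \<in> V \<Longrightarrow> y \<in> V \<Longrightarrow> (\<lambda>q. x q + y q) \<in> V"
    and "\<And>x c. x \<in> V \<Longrightarrow> (\<lambda>q. c * x q) \<in> V"
  shows "\<exists>X\<subseteq>V. finite X \<and> (\<forall>x\<in>V. \<exists>\<nu>. x = (\<lambda>q. \<Sum>y\<in>X. \<nu> y * y q))"
  using assms
proof (induction n arbitrary: V)
  case 0
  have "x = (\<lambda>q. \<Sum>y\<in>{}. c y * y q)" if "x \<in> V" for x c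
    using 0(1)[OF that] by auto
  then show ?case by (intro exI[of _ "{}"]) blast
next
  case (Suc n)
  let ?V = "{x \<in> V. x n = 0}"
  have "x q = 0" if "x \<in> ?V" "n \<le> q" for x q
    using that Suc.prems(1)[of x q] by (cases "q = n") auto
  then have "\<exists>X\<subseteq>?V. finite X \<and> (\<forall>x\<in>?V. \<exists>\<nu>. x = (\<lambda>q. \<Sum>y\<in>X. \<nu> y * y q))"
    by (rule Suc.IH) (use Suc.prems in auto)
  then obtain X where X: "X \<subseteq> ?V" "finite X" "\<And>x. x \<in> ?V \<Longrightarrow> \<exists>\<nu>. x = (\<lambda>q. \<Sum>y\<in>X. \<nu> y * y q)"
    by auto
  show ?case
  proof (cases "?V = V")
    case True
    then show ?thesis using X by (intro exI[of _ X]) auto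
  next
    case False
    then obtain z where z: "z \<in> V" "z n \<noteq> 0" by auto
    then have zX: "z \<notin> X" using X(1) by auto
    have "\<exists>\<nu>. x = (\<lambda>q. \<Sum>y\<in>insert z X. \<nu> y * y q)" if x: "x \<in> V" for x
    proof -
      define c where "c = x n / z n"
      have "(\<lambda>q. x q + (- c) * z q) \<in> V"
        by (rule Suc.prems(2)[OF x Suc.prems(3)[OF z(1)]])
      then have "(\<lambda>q. x q + (- c) * z q) \<in> ?V" using z by (simp add: c_def)
      then obtain \<nu> where \<nu>: "(\<lambda>q. x q + (- c) * z q) = (\<lambda>q. \<Sum>y\<in>X. \<nu> y * y q)"
        using X(3) by blast
      have "x q = (\<Sum>y\<in>insert z X. (\<nu>(z := c)) y * y q)" for q
      proof -
        have "(\<Sum>y\<in>X. (\<nu>(z := c)) y * y q) = (\<Sum>y\<in>X. \<nu> y * y q)"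
          using zX by (intro sum.cong) auto
        then show ?thesis using fun_cong[OF \<nu>, of q] X(2) zX by (simp add: algebra_simps)
      qed
      then show ?thesis by blast
    qed
    then show ?thesis using X z by (intro exI[of _ "insert z X"]) auto
  qed
qed

text \<open>
  A multigraded submodule has a finite minimal set of homogeneous generators: by boundedness it is
  generated by its parts in finitely many degrees, which are finite dimensional.
\<close>

lemma mg_submodule_minimal_generators:
  fixes W :: "('v::finite) monom \<Rightarrow> (nat \<Rightarrow> 'k::field) set"
  assumes "mg_submodule b W"
  shows "\<exists>L. (\<forall>g. mimage L g = W g) \<and> irredundant L"
proof -
  have W_sub: "W g \<subseteq> graded_vecs b g" and W_zero: "(\<lambda>_. 0) \<in> W g"
    and W_add: "x \<in> W g \<Longrightarrow> y \<in> W g \<Longrightarrow> (\<lambda>q. x q + y q) \<in> W g"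
    and W_scale: "x \<in> W g \<Longrightarrow> (\<lambda>q. c * x q) \<in> W g"
    and W_mono: "lookup g \<le> lookup h \<Longrightarrow> W g \<subseteq> W h" for g h x y c
    using assms by (auto simp: mg_submodule_def)
  obtain N where N: "\<And>g. W g \<subseteq> W (cap N g)" using assms by (auto simp: mg_submodule_def)
  let ?adm = "\<lambda>X g (\<nu> :: 'v monom \<times> (nat \<Rightarrow> 'k) \<Rightarrow> 'k). \<forall>y. \<nu> y \<noteq> 0 \<longrightarrow> y \<in> X \<and> lookup (fst y) \<le> lookup g"
  define gen where "gen X \<longleftrightarrow> finite X \<and> (\<forall>y\<in>X. snd y \<in> W (fst y)) \<and>
    (\<forall>g. \<forall>x\<in>W g. \<exists>\<nu>. ?adm X g \<nu> \<and> x = (\<lambda>q. \<Sum>y\<in>X. \<nu> y * snd y q))" for X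
  have "\<exists>X. gen X"
  proof -
    have ex: "\<exists>X\<subseteq>W g. finite X \<and> (\<forall>x\<in>W g. \<exists>\<nu>. x = (\<lambda>q. \<Sum>y\<in>X. \<nu> y * y q))" for g
    proof (rule finite_spanning_set)
      show "x q = 0" if "x \<in> W g" "length b \<le> q" for x q
        using that W_sub[of g] by (force simp: graded_vecs_def)
    qed (auto intro: W_add W_scale)
    define B where
      "B g = (SOME X. X \<subseteq> W g \<and> finite X \<and> (\<forall>x\<in>W g. \<exists>\<nu>. x = (\<lambda>q. \<Sum>y\<in>X. \<nu> y * y q)))" for g
    have "B g \<subseteq> W g \<and> finite (B g) \<and> (\<forall>x\<in>W g. \<exists>\<nu>. x = (\<lambda>q. \<Sum>y\<in>B g. \<nu> y * y q))" for g
      unfolding B_def by (rule someI_ex[OF ex])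
    then have B: "B g \<subseteq> W g" "finite (B g)"
      "x \<in> W g \<Longrightarrow> \<exists>\<nu>. x = (\<lambda>q. \<Sum>y\<in>B g. \<nu> y * y q)" for g x by blast+
    define G where "G = {g :: 'v monom. \<forall>v. lookup g v \<le> N}"
    have G: "finite G" unfolding G_def by (rule finite_bounded_monoms)
    define X where "X = Sigma G B"
    have "\<exists>\<nu>. ?adm X g \<nu> \<and> x = (\<lambda>q. \<Sum>y\<in>X. \<nu> y * snd y q)" if x: "x \<in> W g" for g x
    proof -
      let ?h = "cap N g"
      have h: "?h \<in> G" by (simp add: G_def)
      obtain \<nu> where \<nu>: "x = (\<lambda>q. \<Sum>y\<in>B ?h. \<nu> y * y q)" using B(3) x N by blast
      define \<nu>' where "\<nu>' y = (if fst y = ?h \<and> snd y \<in> B ?h then \<nu> (snd y) else 0)" for y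
      have "?adm X g \<nu>'" using h by (auto simp: \<nu>'_def X_def le_fun_def)
      moreover have "(\<Sum>y\<in>X. \<nu>' y * snd y q) = x q" for q
      proof -
        have "(\<Sum>y\<in>X. \<nu>' y * snd y q) = (\<Sum>h\<in>G. \<Sum>y\<in>B h. \<nu>' (h, y) * y q)"
          unfolding X_def using G B(2) by (subst sum.Sigma) (auto simp: case_prod_beta)
        also have "\<dots> = (\<Sum>h\<in>G. if h = ?h then x q else 0)"
          by (intro sum.cong) (auto simp: \<nu>'_def \<nu>)
        finally show ?thesis using G h by simp
      qed
      ultimately show ?thesis by (intro exI[of _ \<nu>']) auto
    qed
    moreover have "finite X" using G B(2) by (simp add: X_def)
    moreover have "snd y \<in> W (fst y)" if "y \<in> X" for y
      using that subsetD[OF B(1)] by (auto simp: X_def)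
    ultimately have "gen X" unfolding gen_def by blast
    then show ?thesis by blast
  qed
  then obtain X where gen: "gen X" and X_min: "\<And>Y. gen Y \<Longrightarrow> card X \<le> card Y"
    using ex_has_least_nat[of gen _ card] by blast
  have finX: "finite X" and genX: "\<And>y. y \<in> X \<Longrightarrow> snd y \<in> W (fst y)"
    and spanX: "\<And>g x. x \<in> W g \<Longrightarrow> \<exists>\<nu>. ?adm X g \<nu> \<and> x = (\<lambda>q. \<Sum>y\<in>X. \<nu> y * snd y q)"
    using gen unfolding gen_def by blast+
  have irr: "\<mu> z = 0" if z: "z \<in> X" and adm: "?adm X (fst z) \<mu>"
    and rel: "\<And>q. (\<Sum>y\<in>X. \<mu> y * snd y q) = 0" for z \<mu>
  proof (rule ccontr)
    assume nz: "\<mu> z \<noteq> 0"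
    have "\<exists>\<nu>. ?adm (X - {z}) g \<nu> \<and> x = (\<lambda>q. \<Sum>y\<in>X - {z}. \<nu> y * snd y q)" if xW: "x \<in> W g" for g x
    proof -
      obtain \<nu> where \<nu>: "?adm X g \<nu>" "x = (\<lambda>q. \<Sum>y\<in>X. \<nu> y * snd y q)" using spanX[OF xW] by blast
      define c where "c = \<nu> z / \<mu> z"
      define \<nu>' where "\<nu>' y = \<nu> y - c * \<mu> y" for y
      have \<nu>'z: "\<nu>' z = 0" using nz by (simp add: \<nu>'_def c_def)
      have "y \<in> X \<and> lookup (fst y) \<le> lookup g" if "\<nu>' y \<noteq> 0" for y
      proof (cases "\<nu> y \<noteq> 0")
        case True
        then show ?thesis using \<nu>(1) by blast
      next
        case False
        then have "\<mu> y \<noteq> 0" "\<nu> z \<noteq> 0" using that by (auto simp: \<nu>'_def c_def)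
        then have "y \<in> X" "lookup (fst y) \<le> lookup (fst z)" "lookup (fst z) \<le> lookup g"
          using adm \<nu>(1) by blast+
        then show ?thesis by (meson order_trans)
      qed
      then have "?adm (X - {z}) g \<nu>'" using \<nu>'z by blast
      moreover have "(\<Sum>y\<in>X - {z}. \<nu>' y * snd y q) = x q" for q
      proof -
        have "(\<Sum>y\<in>X - {z}. \<nu>' y * snd y q) = (\<Sum>y\<in>X. \<nu>' y * snd y q)"
          using finX z by (simp add: sum.remove[of X z] \<nu>'z)
        also have "\<dots> = (\<Sum>y\<in>X. \<nu> y * snd y q) - c * (\<Sum>y\<in>X. \<mu> y * snd y q)"
          by (simp add: \<nu>'_def algebra_simps sum_subtractf sum_distrib_left)
        finally show ?thesis by (simp add: rel \<nu>(2))
      qed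
      ultimately show ?thesis by (intro exI[of _ \<nu>']) auto
    qed
    then have "gen (X - {z})" using finX genX unfolding gen_def by blast
    from X_min[OF this] show False using card_Diff1_less[OF finX z] by simp
  qed
  obtain L where L: "set L = X" "distinct L" using finX finite_distinct_list by blast
  have bij: "bij_betw ((!) L) {..<length L} X" using L by (intro bij_betw_nth) auto
  have mem: "L ! r \<in> X" if "r < length L" for r using L that nth_mem by blast
  have sum_L: "(\<Sum>r<length L. f (L ! r)) = (\<Sum>y\<in>X. f y)" for f :: "_ \<Rightarrow> 'k"
    by (rule sum.reindex_bij_betw[OF bij])
  have "mimage L g = W g" for g
  proof
    show "mimage L g \<subseteq> W g"
    proof
      fix x assume "x \<in> mimage L g"
      then obtain \<mu> where \<mu>: "\<mu> \<in> graded_vecs (map fst L) g" "x = lin L \<mu>" by (auto simp: mimage_def)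
      have "(\<lambda>q. \<Sum>r\<in>A. \<mu> r * snd (L ! r) q) \<in> W g" if "finite A" "A \<subseteq> {..<length L}" for A
        using that
      proof (induction A rule: finite_induct)
        case empty
        then show ?case by (simp add: W_zero)
      next
        case (insert r A)
        have "(\<lambda>q. \<mu> r * snd (L ! r) q) \<in> W g"
        proof (cases "\<mu> r = 0")
          case False
          then have "lookup (fst (L ! r)) \<le> lookup g" using \<mu>(1) insert.prems
            by (auto simp: graded_vecs_def)
          moreover have "snd (L ! r) \<in> W (fst (L ! r))" using genX mem insert.prems by simp
          ultimately show ?thesis using W_mono by (intro W_scale) blast
        qed (simp add: W_zero)
        then show ?case using insert by (auto intro!: W_add)
      qed
      then show "x \<in> W g" by (simp add: \<mu>(2) lin_def)
    qed
    show "W g \<subseteq> mimage L g"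
    proof
      fix x assume "x \<in> W g"
      then obtain \<nu> where \<nu>: "?adm X g \<nu>" "x = (\<lambda>q. \<Sum>y\<in>X. \<nu> y * snd y q)" using spanX by blast
      define \<mu> where "\<mu> r = (if r < length L then \<nu> (L ! r) else 0)" for r
      have "\<mu> \<in> graded_vecs (map fst L) g" using \<nu>(1) by (simp add: graded_vecs_def \<mu>_def del: split_paired_All)
      moreover have "lin L \<mu> = x"
        using sum_L[of "\<lambda>y. \<nu> y * snd y q" for q] by (auto simp: lin_def \<mu>_def \<nu>(2))
      ultimately show "x \<in> mimage L g" by (auto simp: mimage_def)
    qed
  qed
  moreover have "irredundant L"
    unfolding irredundant_def
  proof (intro allI impI ballI)
    fix p \<mu> assume p: "p < length L" and \<mu>: "\<mu> \<in> mkernel L (fst (L ! p))"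
    define idx where "idx = the_inv_into {..<length L} ((!) L)"
    have idx: "idx (L ! r) = r" if "r < length L" for r
      unfolding idx_def using bij that by (intro the_inv_into_f_f) (auto simp: bij_betw_def)
    define \<nu> where "\<nu> y = (if y \<in> X then \<mu> (idx y) else 0)" for y
    have \<nu>L: "\<nu> (L ! r) = \<mu> r" if "r < length L" for r using that mem idx by (simp add: \<nu>_def)
    have "\<nu> (L ! p) = 0"
    proof (rule irr)
      show "?adm X (fst (L ! p)) \<nu>"
      proof (intro allI impI)
        fix y assume y: "\<nu> y \<noteq> 0"
        then have "y \<in> X" by (metis \<nu>_def)
        then obtain r where "r < length L" "y = L ! r" using L by (metis in_set_conv_nth)
        then show "y \<in> X \<and> lookup (fst y) \<le> lookup (fst (L ! p))"
          using y \<open>y \<in> X\<close> \<mu> \<nu>L by (auto simp: mkernel_def graded_vecs_def)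
      qed
      show "(\<Sum>y\<in>X. \<nu> y * snd y q) = 0" for q
      proof -
        have "(\<Sum>y\<in>X. \<nu> y * snd y q) = lin L \<mu> q"
          unfolding sum_L[symmetric] lin_def by (intro sum.cong) (auto simp: \<nu>L)
        then show ?thesis using \<mu> by (simp add: mkernel_def)
      qed
    qed (use mem p in auto)
    then show "\<mu> p = 0" using \<nu>L p by simp
  qed
  ultimately show ?thesis by blast
qed

definition mon_ideal_part :: "'v monom set \<Rightarrow> 'v monom \<Rightarrow> (nat \<Rightarrow> 'k::field) set" where
  "mon_ideal_part U g = {x. (\<forall>q. q \<noteq> 0 \<longrightarrow> x q = 0) \<and> (x 0 \<noteq> 0 \<longrightarrow> g \<in> U)}"

definition mg_resolution :: "'v monom set \<Rightarrow> (nat \<Rightarrow> ('v, 'k::field) mgens) \<Rightarrow> bool" where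
  "mg_resolution U L \<longleftrightarrow> (\<forall>g. mimage (L 0) g = mon_ideal_part U g) \<and>
     (\<forall>i g. mimage (L (Suc i)) g = mkernel (L i) g)"

lemma mon_ideal_part_graded_vecs:
  assumes "x \<in> mon_ideal_part U g"
  shows "x \<in> graded_vecs [0] g"
proof -
  have "r < length [0] \<and> lookup ([0] ! r) \<le> lookup g" if "x r \<noteq> 0" for r
  proof -
    have "r = 0" using that assms by (auto simp: mon_ideal_part_def)
    then show ?thesis by (simp add: le_fun_def)
  qed
  then show ?thesis by (simp add: graded_vecs_def)
qed

lemma mg_submodule_mon_ideal_part:
  assumes "upset U"
  shows "mg_submodule [0] (mon_ideal_part U :: ('v::finite) monom \<Rightarrow> (nat \<Rightarrow> 'k::field) set)"
proof -
  obtain N where "\<And>g. g \<in> U \<Longrightarrow> cap N g \<in> U" using upset_bounded[OF assms] by blast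
  then have "\<exists>N. \<forall>g. (mon_ideal_part U g :: (nat \<Rightarrow> 'k) set) \<subseteq> mon_ideal_part U (cap N g)"
    by (intro exI[of _ N]) (auto simp: mon_ideal_part_def)
  moreover have "(mon_ideal_part U g :: (nat \<Rightarrow> 'k) set) \<subseteq> graded_vecs [0] g" for g
    using mon_ideal_part_graded_vecs by blast
  ultimately show ?thesis
    using upsetD[OF assms] unfolding mg_submodule_def mon_ideal_part_def by (auto; fastforce)
qed

lemma lin_add: "lin L (\<lambda>r. x r + y r) = (\<lambda>q. lin L x q + lin L y q)"
  by (simp add: lin_def algebra_simps sum.distrib)

lemma lin_scale: "lin L (\<lambda>r. c * x r) = (\<lambda>q. c * lin L x q)"
  by (simp add: lin_def algebra_simps sum_distrib_left)

lemma mg_submodule_mkernel: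
  "mg_submodule (map fst L) (mkernel L :: ('v::finite) monom \<Rightarrow> (nat \<Rightarrow> 'k::field) set)"
proof -
  define N where "N = Max (insert 0 (\<Union>r<length L. Set.range (lookup (fst (L ! r)))))"
  have N: "lookup (fst (L ! r)) v \<le> N" if "r < length L" for r v
    unfolding N_def using that by (intro Max_ge) auto
  have "lookup (fst (L ! r)) \<le> lookup (cap N g)"
    if "r < length L" "lookup (fst (L ! r)) \<le> lookup g" for r g
    using that N by (auto simp: le_fun_def)
  then have "\<exists>N. \<forall>g. mkernel L g \<subseteq> mkernel L (cap N g)"
    by (intro exI[of _ N]) (auto simp: mkernel_def graded_vecs_def)
  moreover have "mkernel L g \<subseteq> mkernel L h" if "lookup g \<le> lookup h" for g h
    using that by (auto simp: mkernel_def graded_vecs_def intro: order_trans)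
  moreover have "(\<lambda>q. x q + y q) \<in> mkernel L g" if "x \<in> mkernel L g" "y \<in> mkernel L g" for x y g
    using that by (auto simp: mkernel_def graded_vecs_def lin_add) (metis add_0)+
  moreover have "(\<lambda>q. c * x q) \<in> mkernel L g" if "x \<in> mkernel L g" for x c g
    using that by (auto simp: mkernel_def graded_vecs_def lin_scale)
  moreover have "(\<lambda>_. 0) \<in> mkernel L g" for g by (simp add: mkernel_def graded_vecs_def lin_def)
  moreover have "mkernel L g \<subseteq> graded_vecs (map fst L) g" for g by (auto simp: mkernel_def)
  ultimately show ?thesis unfolding mg_submodule_def by blast
qed

lemma mg_resolution_exists:
  assumes "upset U"
  shows "\<exists>L :: nat \<Rightarrow> ('v::finite, 'k::field) mgens. mg_resolution U L \<and> (\<forall>i. irredundant (L i))"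
proof -
  have "\<exists>L :: nat \<Rightarrow> ('v, 'k) mgens. \<forall>i. (irredundant (L i) \<and> (i = 0 \<longrightarrow> (\<forall>g. mimage (L i) g = mon_ideal_part U g))) \<and>
      (\<forall>g. mimage (L (Suc i)) g = mkernel (L i) g)"
  proof (rule dependent_nat_choice)
    show "\<exists>L :: ('v, 'k) mgens. irredundant L \<and> (0 = (0::nat) \<longrightarrow> (\<forall>g. mimage L g = mon_ideal_part U g))"
      using mg_submodule_minimal_generators[OF mg_submodule_mon_ideal_part[OF assms]] by blast
    show "\<exists>L'. (irredundant L' \<and> (Suc i = 0 \<longrightarrow> (\<forall>g. mimage L' g = mon_ideal_part U g))) \<and>
        (\<forall>g. mimage L' g = mkernel L g)" for i and L :: "('v, 'k) mgens"
      using mg_submodule_minimal_generators[OF mg_submodule_mkernel[of L]] by auto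
  qed
  then show ?thesis unfolding mg_resolution_def by metis
qed

text \<open>
  The functor that shifts by \<open>c\<close> and keeps the degrees \<open>\<ge> 0\<close> is exact, sends \<open>R/I\<close> to \<open>R/(I : x\<^sup>c)\<close> up to
  isomorphism and \<open>R(-g)\<close> to the free module \<open>R(-max (g - c) 0)\<close>. It keeps all scalars.
\<close>

definition colon_gens :: "'v monom \<Rightarrow> ('v, 'k) mgens \<Rightarrow> ('v, 'k) mgens" where
  "colon_gens c L = map (\<lambda>x. (fst x - c, snd x)) L"

lemma monom_diff_le_iff: "lookup (h - c) \<le> lookup g \<longleftrightarrow> lookup h \<le> lookup (g + c :: 'v monom)"
  by (simp add: le_fun_def lookup_minus lookup_add le_diff_conv)

lemma graded_vecs_colon_gens: "graded_vecs (map fst (colon_gens c L)) g = graded_vecs (map fst L) (g + c)"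
  by (auto simp: graded_vecs_def colon_gens_def monom_diff_le_iff)

lemma lin_colon_gens: "lin (colon_gens c L) = lin L"
  by (auto simp: lin_def colon_gens_def fun_eq_iff)

lemma mg_resolution_colon:
  assumes "mg_resolution U L"
  shows "mg_resolution (colon U c) (\<lambda>i. colon_gens c (L i))"
  using assms
  by (simp add: mg_resolution_def mimage_def mkernel_def graded_vecs_colon_gens lin_colon_gens
      mon_ideal_part_def colon_def)

definition mg_shifts :: "(nat \<Rightarrow> ('v, 'k) mgens) \<Rightarrow> nat \<Rightarrow> 'v monom list" where
  "mg_shifts L i = (case i of 0 \<Rightarrow> [0] | Suc j \<Rightarrow> map fst (L j))"

definition mg_mat :: "'v monom list \<Rightarrow> ('v, 'k::field) mgens \<Rightarrow> ('v, 'k) mpoly mat" where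
  "mg_mat b L = mat (length b) (length L) (\<lambda>(p, q). single (fst (L ! q) - b ! p) (snd (L ! q) p))"

text \<open>The coordinates of the part of degree \<open>g\<close> of an element of \<open>\<Oplus>\<^sub>q R(-b\<^sub>q)\<close>.\<close>

definition fine_part :: "'v monom list \<Rightarrow> 'v monom \<Rightarrow> ('v, 'k::field) mpoly vec \<Rightarrow> nat \<Rightarrow> 'k" where
  "fine_part b g w = (\<lambda>q. if q < length b \<and> lookup (b ! q) \<le> lookup g then lookup (w $ q) (g - b ! q) else 0)"

lemma fine_part_in_graded_vecs: "fine_part b g w \<in> graded_vecs b g"
  by (auto simp: fine_part_def graded_vecs_def)

lemma vec_eq_if_fine_parts_eq:
  assumes "w \<in> carrier_vec (length b)" "w' \<in> carrier_vec (length b)"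
    and "\<And>g. fine_part b g w = fine_part b g w'"
  shows "w = w'"
proof (rule eq_vecI)
  fix q assume "q < dim_vec w'"
  then have q: "q < length b" using assms by simp
  show "w $ q = w' $ q"
  proof (rule poly_mapping_eqI)
    fix m
    have "fine_part b (m + b ! q) w q = fine_part b (m + b ! q) w' q" using assms(3) by simp
    moreover have "lookup (b ! q) \<le> lookup (m + b ! q)" by (simp add: le_fun_def lookup_add)
    ultimately show "lookup (w $ q) m = lookup (w' $ q) m" using q by (simp add: fine_part_def)
  qed
qed (use assms in auto)

lemma fine_part_mg_mat:
  assumes comp: "\<And>r. r < length L \<Longrightarrow> snd (L ! r) \<in> graded_vecs b (fst (L ! r))"
    and w: "w \<in> carrier_vec (length L)"
  shows "fine_part b g (mg_mat b L *\<^sub>v w) = lin L (fine_part (map fst L) g w)"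
proof
  fix p
  let ?g = "\<lambda>r. fst (L ! r)" and ?x = "\<lambda>r. snd (L ! r) p"
  have sup: "p < length b \<and> lookup (b ! p) \<le> lookup (?g r)" if "r < length L" "?x r \<noteq> 0" for r
    using comp[OF that(1)] that(2) by (auto simp: graded_vecs_def)
  show "fine_part b g (mg_mat b L *\<^sub>v w) p = lin L (fine_part (map fst L) g w) p"
  proof (cases "p < length b \<and> lookup (b ! p) \<le> lookup g")
    case True
    have "(mg_mat b L *\<^sub>v w) $ p = (\<Sum>r<length L. single (?g r - b ! p) (?x r) * w $ r)"
      using True w by (auto simp: mg_mat_def scalar_prod_def atLeast0LessThan intro!: sum.cong)
    then have "fine_part b g (mg_mat b L *\<^sub>v w) p
        = (\<Sum>r<length L. lookup (single (?g r - b ! p) (?x r) * w $ r) (g - b ! p))"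
      using True by (simp add: fine_part_def lookup_sum)
    also have "\<dots> = (\<Sum>r<length L. fine_part (map fst L) g w r * ?x r)"
    proof (rule sum.cong)
      fix r assume "r \<in> {..<length L}"
      then have r: "r < length L" by simp
      show "lookup (single (?g r - b ! p) (?x r) * w $ r) (g - b ! p) = fine_part (map fst L) g w r * ?x r"
      proof (cases "?x r = 0")
        case False
        then have bp: "lookup (b ! p) \<le> lookup (?g r)" using sup[OF r] by simp
        have "lookup (?g r - b ! p) \<le> lookup (g - b ! p) \<longleftrightarrow> lookup (?g r) \<le> lookup g"
          using True by (simp add: monom_diff_le_iff monom_diff_add)
        moreover have "g - b ! p - (?g r - b ! p) = g - ?g r"
          using bp by (intro poly_mapping_eqI) (simp add: lookup_minus le_fun_def)
        ultimately show ?thesis using r by (simp add: lookup_single_times fine_part_def)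
      qed simp
    qed simp
    finally show ?thesis by (simp add: lin_def)
  next
    case False
    have "fine_part (map fst L) g w r * ?x r = 0" if r: "r < length L" for r
    proof (rule ccontr)
      assume "\<not> ?thesis"
      then have "?x r \<noteq> 0" "lookup (?g r) \<le> lookup g" using r by (auto simp: fine_part_def split: if_splits)
      then show False using sup[OF r] False order_trans by blast
    qed
    then have "lin L (fine_part (map fst L) g w) p = 0" unfolding lin_def by (intro sum.neutral) simp
    moreover have "fine_part b g (mg_mat b L *\<^sub>v w) p = 0" using False by (simp only: fine_part_def if_False)
    ultimately show ?thesis by simp
  qed
qed

text \<open>Preimages can be chosen degree by degree, since only finitely many degrees occur in a vector.\<close>

lemma mat_image_mg_mat:
  assumes comp: "\<And>r. r < length L \<Longrightarrow> snd (L ! r) \<in> graded_vecs b (fst (L ! r))"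
  shows "mat_image (mg_mat b L) = {w \<in> carrier_vec (length b). \<forall>g. fine_part b g w \<in> mimage L g}"
proof
  have carrier: "mg_mat b L \<in> carrier_mat (length b) (length L)" by (simp add: mg_mat_def)
  show "mat_image (mg_mat b L) \<subseteq> {w \<in> carrier_vec (length b). \<forall>g. fine_part b g w \<in> mimage L g}"
    using carrier
    by (auto simp: mat_image_def mimage_def fine_part_mg_mat[OF comp]
        intro: imageI[OF fine_part_in_graded_vecs])
  show "{w \<in> carrier_vec (length b). \<forall>g. fine_part b g w \<in> mimage L g} \<subseteq> mat_image (mg_mat b L)"
  proof clarify
    fix w assume w: "w \<in> carrier_vec (length b)" and im: "\<forall>g. fine_part b g w \<in> mimage L g"
    have "\<exists>\<mu>. \<mu> \<in> graded_vecs (map fst L) g \<and> lin L \<mu> = fine_part b g w" for g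
    proof -
      have "fine_part b g w \<in> lin L ` graded_vecs (map fst L) g" using im by (simp add: mimage_def)
      then show ?thesis by (metis imageE)
    qed
    then obtain \<mu> where \<mu>: "\<And>g. \<mu> g \<in> graded_vecs (map fst L) g" "\<And>g. lin L (\<mu> g) = fine_part b g w"
      by metis
    (* the degrees in which w can have a nonzero part *)
    define G where "G = (\<Union>q<length b. (\<lambda>m. m + b ! q) ` keys (w $ q))"
    have G: "finite G" by (simp add: G_def)
    have off: "fine_part b g w = (\<lambda>_. 0)" if "g \<notin> G" for g
    proof (rule ccontr)
      assume "fine_part b g w \<noteq> (\<lambda>_. 0)"
      then obtain q where q: "q < length b" "lookup (b ! q) \<le> lookup g" "g - b ! q \<in> keys (w $ q)"
        by (auto simp: fine_part_def in_keys_iff fun_eq_iff split: if_splits)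
      then have "g \<in> G" by (auto simp: G_def image_iff intro!: bexI[of _ q] bexI[of _ "g - b ! q"] monom_diff_add[symmetric])
      then show False using that by simp
    qed
    define w' where "w' = vec (length L) (\<lambda>r. \<Sum>h\<in>{h \<in> G. lookup (fst (L ! r)) \<le> lookup h}. single (h - fst (L ! r)) (\<mu> h r))"
    have w': "w' \<in> carrier_vec (length L)" by (simp add: w'_def)
    have part: "fine_part (map fst L) g w' = (if g \<in> G then \<mu> g else (\<lambda>_. 0))" for g
    proof
      fix r
      show "fine_part (map fst L) g w' r = (if g \<in> G then \<mu> g else (\<lambda>_. 0)) r"
      proof (cases "r < length L \<and> lookup (fst (L ! r)) \<le> lookup g")
        case True
        have inj: "h - fst (L ! r) = g - fst (L ! r) \<longleftrightarrow> h = g" if "lookup (fst (L ! r)) \<le> lookup h" for h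
          using monom_diff_add[OF that] True monom_diff_add[of "fst (L ! r)" g] by metis
        have "fine_part (map fst L) g w' r
            = (\<Sum>h\<in>{h \<in> G. lookup (fst (L ! r)) \<le> lookup h}. lookup (single (h - fst (L ! r)) (\<mu> h r)) (g - fst (L ! r)))"
          using True by (simp add: fine_part_def w'_def lookup_sum)
        also have "\<dots> = (\<Sum>h\<in>{h \<in> G. lookup (fst (L ! r)) \<le> lookup h}. if h = g then \<mu> g r else 0)"
          by (intro sum.cong) (auto simp: lookup_single inj when_def)
        also have "\<dots> = (if g \<in> G then \<mu> g r else 0)" using G True by simp
        finally show ?thesis by simp
      next
        case False
        then have "\<mu> g r = 0" using \<mu>(1)[of g] by (auto simp: graded_vecs_def)
        then show ?thesis using False by (auto simp: fine_part_def)
      qed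
    qed
    have zero: "lin L (\<lambda>_. 0) = (\<lambda>_. 0)" by (simp add: lin_def)
    have "mg_mat b L *\<^sub>v w' = w"
    proof (rule vec_eq_if_fine_parts_eq)
      show "fine_part b g (mg_mat b L *\<^sub>v w') = fine_part b g w" for g
        using \<mu>(2)[of g] off[of g] by (simp add: fine_part_mg_mat[OF comp w'] part zero)
    qed (use w carrier w' in auto)
    then show "w \<in> mat_image (mg_mat b L)"
      using w' carrier by (auto simp: mat_image_def intro!: image_eqI[of _ _ w'])
  qed
qed

lemma mat_kernel_mg_mat:
  assumes comp: "\<And>r. r < length L \<Longrightarrow> snd (L ! r) \<in> graded_vecs b (fst (L ! r))"
  shows "mat_kernel (mg_mat b L) = {w \<in> carrier_vec (length L). \<forall>g. fine_part (map fst L) g w \<in> mkernel L g}"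
proof -
  have carrier: "mg_mat b L \<in> carrier_mat (length b) (length L)" by (simp add: mg_mat_def)
  have zero: "fine_part b g (0\<^sub>v (length b)) = (\<lambda>_. 0)" for g by (auto simp: fine_part_def)
  have "mg_mat b L *\<^sub>v w = 0\<^sub>v (length b) \<longleftrightarrow> (\<forall>g. fine_part (map fst L) g w \<in> mkernel L g)"
    if w: "w \<in> carrier_vec (length L)" for w
  proof
    assume "mg_mat b L *\<^sub>v w = 0\<^sub>v (length b)"
    then show "\<forall>g. fine_part (map fst L) g w \<in> mkernel L g"
      by (simp add: mkernel_def fine_part_in_graded_vecs fine_part_mg_mat[OF comp w, symmetric] zero)
  next
    assume "\<forall>g. fine_part (map fst L) g w \<in> mkernel L g"
    then have "fine_part b g (mg_mat b L *\<^sub>v w) = fine_part b g (0\<^sub>v (length b))" for g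
      by (simp add: mkernel_def fine_part_mg_mat[OF comp w] zero)
    then show "mg_mat b L *\<^sub>v w = 0\<^sub>v (length b)"
      using carrier w by (intro vec_eq_if_fine_parts_eq) auto
  qed
  then show ?thesis unfolding mat_kernel[OF carrier] by blast
qed

lemma mg_gens_in_mimage:
  assumes "r < length L"
  shows "snd (L ! r) \<in> mimage L (fst (L ! r))"
proof -
  let ?e = "\<lambda>s. if s = r then 1 else 0 :: 'b::field"
  have "?e \<in> graded_vecs (map fst L) (fst (L ! r))" using assms by (auto simp: graded_vecs_def)
  moreover have "lin L ?e = snd (L ! r)"
    using assms by (auto simp: lin_def if_distrib[where f = "\<lambda>x. x * _"] cong: if_cong)
  ultimately show ?thesis by (metis imageI mimage_def)
qed

lemma mg_resolution_compatible:
  assumes "mg_resolution U L" and "r < length (L i)"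
  shows "snd (L i ! r) \<in> graded_vecs (mg_shifts L i) (fst (L i ! r))"
proof (cases i)
  case 0
  then have "snd (L i ! r) \<in> mon_ideal_part U (fst (L i ! r))"
    using assms mg_gens_in_mimage[OF assms(2)] by (simp add: mg_resolution_def)
  then show ?thesis using 0 mon_ideal_part_graded_vecs by (simp add: mg_shifts_def)
next
  case (Suc j)
  then have "snd (L i ! r) \<in> mkernel (L j) (fst (L i ! r))"
    using assms mg_gens_in_mimage[OF assms(2)] by (simp add: mg_resolution_def)
  then show ?thesis using Suc by (simp add: mg_shifts_def mkernel_def)
qed

lemma mg_resolution_graded_free_resolution:
  fixes L :: "nat \<Rightarrow> ('v::finite, 'k::field) mgens"
  assumes res: "mg_resolution U L"
  shows "graded_free_resolution (mon_ideal U) (\<lambda>i. map (\<lambda>g. int (mdeg g)) (mg_shifts L i))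
    (\<lambda>i. mg_mat (mg_shifts L i) (L i))"
proof -
  note comp = mg_resolution_compatible[OF res]
  have len: "length (mg_shifts L (Suc i)) = length (L i)" for i by (simp add: mg_shifts_def)
  have kernel: "mat_kernel (mg_mat (mg_shifts L i) (L i))
      = {w \<in> carrier_vec (length (L i)). \<forall>g. fine_part (map fst (L i)) g w \<in> mkernel (L i) g}"
    and image: "mat_image (mg_mat (mg_shifts L i) (L i))
      = {w \<in> carrier_vec (length (mg_shifts L i)). \<forall>g. fine_part (mg_shifts L i) g w \<in> mimage (L i) g}" for i
    by (rule mat_kernel_mg_mat, erule comp) (rule mat_image_mg_mat, erule comp)
  show ?thesis
    unfolding graded_free_resolution_def
  proof (intro conjI allI impI ballI)
    show "map (\<lambda>g. int (mdeg g)) (mg_shifts L 0) = [0]" by (simp add: mg_shifts_def mdeg_def)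
    show "mg_mat (mg_shifts L i) (L i) \<in> carrier_mat (length (map (\<lambda>g. int (mdeg g)) (mg_shifts L i)))
        (length (map (\<lambda>g. int (mdeg g)) (mg_shifts L (Suc i))))" for i
      by (simp add: mg_mat_def len)
    fix i
    show "int (mdeg m) = map (\<lambda>g. int (mdeg g)) (mg_shifts L (Suc i)) ! q - map (\<lambda>g. int (mdeg g)) (mg_shifts L i) ! p"
      if p: "p < length (map (\<lambda>g. int (mdeg g)) (mg_shifts L i))" and q: "q < length (map (\<lambda>g. int (mdeg g)) (mg_shifts L (Suc i)))"
        and m: "m \<in> keys (mg_mat (mg_shifts L i) (L i) $$ (p, q))" for p q m
    proof -
      have q': "q < length (L i)" and p': "p < length (mg_shifts L i)" using p q len by simp_all
      have m': "m = fst (L i ! q) - mg_shifts L i ! p" "snd (L i ! q) p \<noteq> 0"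
        using m p' q' by (auto simp: mg_mat_def split: if_splits)
      then have "lookup (mg_shifts L i ! p) \<le> lookup (fst (L i ! q))"
        using comp[OF q'] by (auto simp: graded_vecs_def)
      then have "mdeg (fst (L i ! q)) = mdeg m + mdeg (mg_shifts L i ! p)"
        by (simp add: m'(1) mdeg_add[symmetric] monom_diff_add)
      moreover have "mg_shifts L (Suc i) ! q = fst (L i ! q)" using q' by (simp add: mg_shifts_def)
      ultimately show ?thesis using p q by simp
    qed
    show "mat_kernel (mg_mat (mg_shifts L i) (L i)) = mat_image (mg_mat (mg_shifts L (Suc i)) (L (Suc i)))"
      unfolding kernel image using res by (simp add: mg_resolution_def mg_shifts_def)
  next
    have "(\<forall>g. fine_part [0] g w \<in> mon_ideal_part U g) \<longleftrightarrow> w $ 0 \<in> mon_ideal U" for w :: "('v, 'k) mpoly vec"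
      by (auto simp: fine_part_def mon_ideal_part_def mon_ideal_def in_keys_iff le_fun_def)
    moreover have "mimage (L 0) = mon_ideal_part U" using res by (auto simp: mg_resolution_def)
    ultimately show "mat_image (mg_mat (mg_shifts L 0) (L 0)) = {v \<in> carrier_vec 1. v $ 0 \<in> mon_ideal U}"
      unfolding image by (simp add: mg_shifts_def)
  qed
qed

text \<open>
  A nonzero constant entry in row \<open>p\<close> of a matrix is a relation that expresses the \<open>p\<close>-th generator
  of the preceding step by the other ones.
\<close>

lemma mg_resolution_minimal:
  fixes L :: "nat \<Rightarrow> ('v::finite, 'k::field) mgens"
  assumes res: "mg_resolution U L" and irr: "\<And>i. irredundant (L i)" and U: "0 \<notin> U"
  shows "minimal_graded_free_resolution (mon_ideal U) (\<lambda>i. map (\<lambda>g. int (mdeg g)) (mg_shifts L i))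
    (\<lambda>i. mg_mat (mg_shifts L i) (L i))"
  unfolding minimal_graded_free_resolution_def
proof (intro conjI allI subsetI)
  show "graded_free_resolution (mon_ideal U) (\<lambda>i. map (\<lambda>g. int (mdeg g)) (mg_shifts L i))
      (\<lambda>i. mg_mat (mg_shifts L i) (L i))"
    by (rule mg_resolution_graded_free_resolution[OF res])
  fix i a assume "a \<in> elements_mat (mg_mat (mg_shifts L i) (L i))"
  then obtain p q where p: "p < length (mg_shifts L i)" and q: "q < length (L i)"
    and a: "a = single (fst (L i ! q) - mg_shifts L i ! p) (snd (L i ! q) p)"
    by (auto simp: mg_mat_def)
  show "a \<in> graded_maximal_ideal"
  proof (rule ccontr)
    assume "a \<notin> graded_maximal_ideal"
    then have nz: "snd (L i ! q) p \<noteq> 0" and eq: "fst (L i ! q) - mg_shifts L i ! p = 0"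
      by (auto simp: in_graded_maximal_ideal_iff a lookup_single when_def split: if_splits)
    have "lookup (mg_shifts L i ! p) \<le> lookup (fst (L i ! q))"
      using mg_resolution_compatible[OF res q] nz by (auto simp: graded_vecs_def)
    from monom_diff_add[OF this] have deg: "mg_shifts L i ! p = fst (L i ! q)" using eq by simp
    show False
    proof (cases i)
      case 0
      then have "snd (L i ! q) \<in> mon_ideal_part U (fst (L i ! q))"
        using res mg_gens_in_mimage[OF q] by (simp add: mg_resolution_def)
      moreover have "p = 0" "fst (L i ! q) = 0" using 0 p deg by (auto simp: mg_shifts_def)
      ultimately show False using nz U by (simp add: mon_ideal_part_def)
    next
      case (Suc j)
      then have "snd (L i ! q) \<in> mkernel (L j) (fst (L i ! q))"
        using res mg_gens_in_mimage[OF q] by (simp add: mg_resolution_def)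
      moreover have "p < length (L j)" "fst (L i ! q) = fst (L j ! p)"
        using Suc p deg by (auto simp: mg_shifts_def)
      ultimately show False using irr[of j] nz by (auto simp: irredundant_def)
    qed
  qed
qed

theorem reg_quot_colon:
  fixes U :: "('v::finite) monom set"
  assumes U: "upset U" and c: "c \<notin> U"
  shows "reg_quot (mon_ideal (colon U c) :: ('v, 'k::field) mpoly set) \<le> reg_quot (mon_ideal U :: ('v, 'k) mpoly set)"
proof -
  let ?I = "mon_ideal U :: ('v, 'k) mpoly set" and ?I' = "mon_ideal (colon U c) :: ('v, 'k) mpoly set"
  have exists: "\<exists>L. mg_resolution V L \<and> minimal_graded_free_resolution (mon_ideal V)
      (\<lambda>i. map (\<lambda>g. int (mdeg g)) (mg_shifts L i)) (\<lambda>i. mg_mat (mg_shifts L i) (L i :: ('v, 'k) mgens))"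
    if "upset V" "0 \<notin> V" for V
    using mg_resolution_exists[OF that(1)] mg_resolution_minimal[OF _ _ that(2)] by blast
  have chosen: "\<exists>\<phi>. minimal_graded_free_resolution (mon_ideal V :: ('v, 'k) mpoly set) (minimal_shifts (mon_ideal V :: ('v, 'k) mpoly set)) \<phi>"
    if "upset V" "0 \<notin> V" for V
  proof -
    have "\<exists>d \<phi>. minimal_graded_free_resolution (mon_ideal V :: ('v, 'k) mpoly set) d \<phi>"
      using exists[OF that] by blast
    then show ?thesis
      unfolding minimal_shifts_def
      by (rule someI_ex[where P = "\<lambda>d. \<exists>\<phi>. minimal_graded_free_resolution
        (mon_ideal V :: ('v, 'k) mpoly set) d \<phi>"])
  qed
  have "0 \<notin> U" using c upsetD[OF U, of 0 c] by (auto simp: le_fun_def)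
  have "0 \<notin> colon U c" using c by (simp add: colon_def)
  obtain L :: "nat \<Rightarrow> ('v, 'k) mgens" where L: "mg_resolution U L"
    and L_min: "minimal_graded_free_resolution ?I (\<lambda>i. map (\<lambda>g. int (mdeg g)) (mg_shifts L i)) (\<lambda>i. mg_mat (mg_shifts L i) (L i))"
    using exists[OF U \<open>0 \<notin> U\<close>] by blast
  let ?L' = "\<lambda>i. colon_gens c (L i)"
  have bound: "\<exists>j'\<ge>j. j' \<in> set (minimal_shifts ?I i)" if "j \<in> set (minimal_shifts ?I' i)" for i j
  proof -
    obtain \<phi> where "minimal_graded_free_resolution ?I' (minimal_shifts ?I') \<phi>"
      using chosen[OF upset_colon[OF U] \<open>0 \<notin> colon U c\<close>] by blast
    from minimal_resolution_shifts_subset[OF this mg_resolution_graded_free_resolution[OF mg_resolution_colon[OF L, of c]]]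
    have "j \<in> set (map (\<lambda>g. int (mdeg g)) (mg_shifts ?L' i))" using that by blast
    then obtain g' where g': "g' \<in> set (mg_shifts ?L' i)" "j = int (mdeg g')" by auto
    obtain g where g: "g \<in> set (mg_shifts L i)" "g' = g - c"
    proof (cases i)
      case 0
      moreover have "0 - c = (0 :: 'v monom)" by (rule poly_mapping_eqI) (simp add: lookup_minus)
      ultimately show ?thesis using that[of 0] g' by (simp add: mg_shifts_def)
    next
      case (Suc k)
      then show ?thesis using g' that by (auto simp: mg_shifts_def colon_gens_def)
    qed
    have "mdeg g' \<le> mdeg g" unfolding g(2) mdeg_eq_sum by (intro sum_mono) (simp add: lookup_minus)
    moreover have "int (mdeg g) \<in> set (minimal_shifts ?I i)"
    proof -
      obtain \<psi> where "minimal_graded_free_resolution ?I (minimal_shifts ?I) \<psi>"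
        using chosen[OF U \<open>0 \<notin> U\<close>] by blast
      then have "graded_free_resolution ?I (minimal_shifts ?I) \<psi>"
        by (simp add: minimal_graded_free_resolution_def)
      from minimal_resolution_shifts_subset[OF L_min this, of i] show ?thesis using g(1) by auto
    qed
    ultimately show ?thesis using g'(2) by (intro exI[of _ "int (mdeg g)"]) simp
  qed
  show ?thesis
    unfolding reg_quot_def
  proof (rule SUP_least)
    fix x assume "x \<in> {(i, j). graded_betti ?I' i j \<noteq> 0}"
    then obtain i j where x: "x = (i, j)" and "graded_betti ?I' i j \<noteq> 0" by auto
    then have "j \<in> set (minimal_shifts ?I' i)" by (simp add: graded_betti_def count_list_0_iff)
    then obtain j' where j': "j \<le> j'" "j' \<in> set (minimal_shifts ?I i)" using bound by blast
    then have "(i, j') \<in> {(i, j). graded_betti ?I i j \<noteq> 0}"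
      by (simp add: graded_betti_def count_list_0_iff)
    then show "(case x of (i, j) \<Rightarrow> ereal (real_of_int (j - int i)))
        \<le> (SUP (i, j)\<in>{(i, j). graded_betti ?I i j \<noteq> 0}. ereal (real_of_int (j - int i)))"
      by (rule SUP_upper2) (use j'(1) x in simp)
  qed
qed


section \<open>Strongly perfect graphs\<close>

theorem proposition5p8:
  fixes E :: "'v::finite \<Rightarrow> 'v \<Rightarrow> bool"
    and J :: "('v, 'k::field) mpoly set"
  assumes "symp E" and "irreflp E"
    and "strongly_perfect E"
    and "J = edge_ideal (blocker (clique_clutter E))"
  shows "(\<forall>k\<ge>1. depth_quot (symbolic_power J k) \<ge> depth_quot (symbolic_power J (k + 1))) \<and>
         (\<forall>k\<ge>1. reg_quot (symbolic_power J k) \<le> reg_quot (symbolic_power J (k + 1)))"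
proof -
  let ?H = "clique_clutter E"
  obtain C where C: "\<And>e. e \<in> ?H \<Longrightarrow> card (C \<inter> e) = 1"
    using spec[OF assms(3)[unfolded strongly_perfect_def], of UNIV] by (auto simp: clique_clutter_def)
  have clutter: "e = e'" if "e \<in> ?H" "e' \<in> ?H" "e \<subseteq> e'" for e e'
    using that by (auto simp: clique_clutter_def maximal_clique_def)
  have J: "symbolic_power J k = mon_ideal (cover_upset ?H k)" for k
    unfolding assms(4) by (rule symbolic_power_cover_ideal) (rule clutter)
  have step: "cover_upset ?H k = colon (cover_upset ?H (k + 1)) (set_monom C)" for k
    unfolding Suc_eq_plus1[symmetric] by (rule cover_upset_eq_colon) (rule C)
  (* A maximal clique e keeps the product of the variables in C out of the symbolic powers from the second
     on, since its degree with respect to e is 1. *)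
  obtain e where e: "e \<in> ?H"
  proof -
    have "clique E UNIV {}" by (simp add: clique_def)
    then obtain e where "clique E UNIV e" "\<And>S. clique E UNIV S \<Longrightarrow> e \<subseteq> S \<Longrightarrow> e = S"
      using finite_has_maximal2[of "{S. clique E UNIV S}" "{}"] by auto
    then show ?thesis using that by (auto simp: clique_clutter_def maximal_clique_def)
  qed
  have notin: "set_monom C \<notin> cover_upset ?H (k + 1)" if "k \<ge> 1" for k
  proof
    assume "set_monom C \<in> cover_upset ?H (k + 1)"
    then have "k + 1 \<le> (\<Sum>v\<in>e. lookup (set_monom C) v)"
      using e by (auto simp: cover_upset_def degree_ge_def)
    also have "\<dots> = card (C \<inter> e)" by (simp add: lookup_set_monom sum.If_cases Int_commute)
    finally show False using C[OF e] that by simp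
  qed
  have "depth_quot (symbolic_power J (k + 1)) \<le> depth_quot (symbolic_power J k)" if "k \<ge> 1" for k
    unfolding J step[of k] by (rule depth_quot_colon[OF upset_cover_upset notin[OF that]])
  moreover have "reg_quot (symbolic_power J k) \<le> reg_quot (symbolic_power J (k + 1))" if "k \<ge> 1" for k
    unfolding J step[of k] by (rule reg_quot_colon[OF upset_cover_upset notin[OF that]])
  ultimately show ?thesis by blast
qed

end
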